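(* The cohomology of the complex $\mathcal K^\bullet(A,A)$ satisfies $H^i(\mathcal K^\bullet(A,A))=0$ for $i=0,1,\dots,m-1$, and \[\dim_{\mathbb C(\lambda)}H^m(\mathcal K^\bullet(A,A))=\sum_{B\subseteq A}(-1)^{|A\setminus B|}\,|\mathcal B\cap C(B)|.\]
   Context: Let $A=\{\mathbf a_1,\dots,\mathbf a_m\}\subseteq\mathbb Z^n$ be linearly independent over $\mathbb R$, $\mathbf a_0\in\mathbb Z^n$, and $\ell_0,\dots,\ell_m$ positive integers with gcd $1$, $\ell_0\mathbf a_0=\sum_{j=1}^m\ell_j\mathbf a_j$, $\ell_0=\sum_{j=1}^m\ell_j$. Let $V$ be the real span of $A$, $V_{\mathbb Z}=V\cap\mathbb Z^n$, $C(B)$ the closed real cone generated by a subset $B\subseteq A$ (with $C(\emptyset)=\{0\}$), $M=V_{\mathbb Z}\cap C(A)$. Let $S'$ be the $\mathbb C(\lambda)$-span of $\{x^u:u\in M\}$ in $\mathbb C(\lambda)[x_1^{\pm1},\dots,x_n^{\pm1}]$. For $u\in M$ write $u=\sum_{j=1}^mu'_j\mathbf a_j$, and define $\mathbb C(\lambda)$-linear operators $\tilde D_j$ on $S'$ ($j=1,\dots,m$) by $\tilde D_j(x^u)=u'_jx^u+\ell_jx^u(x^{\mathbf a_j}-\lambda x^{\mathbf a_0})$ (these are the operators $\sum_l\beta_{jl}D_l$, $D_l=x_l\partial/\partial x_l+x_l\partial f_\lambda/\partial x_l$, $f_\lambda=\sum_j\ell_jx^{\mathbf a_j}-\ell_0\lambda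 x^{\mathbf a_0}$, for a rational matrix $\beta$ with $\beta\alpha=\binom{I_m}{0}$, $\alpha$ the matrix with columns $\mathbf a_j$). For $T\subseteq A$ let $S'_{A,T}$ be the $\mathbb C(\lambda)$-span of those $x^u$, $u\in M$, with $u'_j>0$ whenever $\mathbf a_j\in T$. Define the complex $\mathcal K^\bullet(A,A)$ by $\mathcal K^k(A,A)=\bigoplus_{j_1<\dots<j_k}S'_{A,\{\mathbf a_{j_1},\dots,\mathbf a_{j_k}\}}\,e_{j_1}\wedge\dots\wedge e_{j_k}$ with differential $\nabla(\xi\,e_{j_1}\wedge\dots\wedge e_{j_k})=\big(\sum_{j=1}^m\tilde D_j(\xi)e_j\big)\wedge e_{j_1}\wedge\dots\wedge e_{j_k}$ (a subcomplex of the Koszul complex of $S'$ with respect to $\tilde D_1,\dots,\tilde D_m$). Let $P(A)=\{\sum_jc_j\mathbf a_j:0\le c_j<1\}$ and $\mathcal B=V_{\mathbb Z}\cap P(A)$. *)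

theory Defs
  imports "HOL-Computational_Algebra.Fraction_Field" "HOL-Computational_Algebra.Polynomial"
begin

type_synonym ratfun = "complex poly fract"

definition lam :: ratfun where "lam = Fraction_Field.Fract [:0, 1:] 1"
definition cst :: "complex \<Rightarrow> ratfun" where "cst c = Fraction_Field.Fract [:c:] 1"

text \<open>Vectors of Z^n are functions 'n => int for a finite index type 'n.
  The family a_0, ..., a_m is a :: nat => 'n => int; A = {a 1, ..., a m}.
  Subsets B of A are represented by index sets T \<subseteq> {1..m}.\<close>

definition is_coords :: "nat \<Rightarrow> (nat \<Rightarrow> 'n \<Rightarrow> int) \<Rightarrow> ('n \<Rightarrow> int) \<Rightarrow> (nat \<Rightarrow> real) \<Rightarrow> bool" where
  "is_coords m a u c \<longleftrightarrow> (\<forall>j. j \<notin> {1..m} \<longrightarrow> c j = 0) \<and>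
      (\<forall>i. real_of_int (u i) = (\<Sum>j\<in>{1..m}. c j * real_of_int (a j i)))"

definition VZ :: "nat \<Rightarrow> (nat \<Rightarrow> 'n \<Rightarrow> int) \<Rightarrow> ('n \<Rightarrow> int) set" where
  "VZ m a = {u. \<exists>c. is_coords m a u c}"

definition coords :: "nat \<Rightarrow> (nat \<Rightarrow> 'n \<Rightarrow> int) \<Rightarrow> ('n \<Rightarrow> int) \<Rightarrow> nat \<Rightarrow> real" where
  "coords m a u = (THE c. is_coords m a u c)"

definition in_cone :: "nat \<Rightarrow> (nat \<Rightarrow> 'n \<Rightarrow> int) \<Rightarrow> nat set \<Rightarrow> ('n \<Rightarrow> int) \<Rightarrow> bool" where
  "in_cone m a T u \<longleftrightarrow> (\<exists>c. is_coords m a u c \<and> (\<forall>j. 0 \<le> c j) \<and> (\<forall>j. j \<notin> T \<longrightarrow> c j = 0))"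

definition Mset :: "nat \<Rightarrow> (nat \<Rightarrow> 'n \<Rightarrow> int) \<Rightarrow> ('n \<Rightarrow> int) set" where
  "Mset m a = {u. in_cone m a {1..m} u}"

definition calB :: "nat \<Rightarrow> (nat \<Rightarrow> 'n \<Rightarrow> int) \<Rightarrow> ('n \<Rightarrow> int) set" where
  "calB m a = {u. \<exists>c. is_coords m a u c \<and> (\<forall>j\<in>{1..m}. 0 \<le> c j \<and> c j < 1)}"

text \<open>Elements of S' are coefficient functions (u \<mapsto> coefficient of x^u),
  finitely supported in M.  S'_{A,T}: in addition u'_j > 0 for j \<in> T.\<close>
definition Sp :: "nat \<Rightarrow> (nat \<Rightarrow> 'n \<Rightarrow> int) \<Rightarrow> nat set \<Rightarrow> (('n \<Rightarrow> int) \<Rightarrow> ratfun) set" where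
  "Sp m a T = {\<xi>. finite {u. \<xi> u \<noteq> 0} \<and>
      (\<forall>u. \<xi> u \<noteq> 0 \<longrightarrow> u \<in> Mset m a \<and> (\<forall>j\<in>T. coords m a u j > 0))}"

text \<open>D~_j(x^u) = u'_j x^u + l_j x^u (x^{a_j} - lambda x^{a_0}), on coefficient functions\<close>
definition Dtil :: "nat \<Rightarrow> (nat \<Rightarrow> 'n \<Rightarrow> int) \<Rightarrow> (nat \<Rightarrow> nat) \<Rightarrow> nat \<Rightarrow>
    (('n \<Rightarrow> int) \<Rightarrow> ratfun) \<Rightarrow> (('n \<Rightarrow> int) \<Rightarrow> ratfun)" where
  "Dtil m a l j \<xi> = (\<lambda>v. cst (complex_of_real (coords m a v j)) * \<xi> v
       + of_nat (l j) * \<xi> (\<lambda>i. v i - a j i)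
       - of_nat (l j) * lam * \<xi> (\<lambda>i. v i - a 0 i))"

text \<open>k-cochains of K(A,A): \<omega> J is the coefficient of e_J (J = {j_1 < ... < j_k}).\<close>
definition cochains :: "nat \<Rightarrow> (nat \<Rightarrow> 'n \<Rightarrow> int) \<Rightarrow> nat \<Rightarrow>
    (nat set \<Rightarrow> ('n \<Rightarrow> int) \<Rightarrow> ratfun) set" where
  "cochains m a k = {\<omega>. \<forall>J. (J \<subseteq> {1..m} \<and> card J = k \<longrightarrow> \<omega> J \<in> Sp m a J) \<and>
       (\<not> (J \<subseteq> {1..m} \<and> card J = k) \<longrightarrow> \<omega> J = (\<lambda>u. 0))}"

text \<open>nabla(\<xi> e_J) = (\<Sum>_j D~_j(\<xi>) e_j) \<and> e_J, with e_j \<and> e_{I-{j}} = (-1)^{#{i\<in>I. i<j}} e_I.\<close>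
definition nabla :: "nat \<Rightarrow> (nat \<Rightarrow> 'n \<Rightarrow> int) \<Rightarrow> (nat \<Rightarrow> nat) \<Rightarrow>
    (nat set \<Rightarrow> ('n \<Rightarrow> int) \<Rightarrow> ratfun) \<Rightarrow> (nat set \<Rightarrow> ('n \<Rightarrow> int) \<Rightarrow> ratfun)" where
  "nabla m a l \<omega> = (\<lambda>I. if I \<subseteq> {1..m} then
      (\<lambda>v. \<Sum>j\<in>I. (-1) ^ card {i\<in>I. i < j} * Dtil m a l j (\<omega> (I - {j})) v)
    else (\<lambda>v. 0))"

definition cocycles where
  "cocycles m a l k = {\<omega> \<in> cochains m a k. nabla m a l \<omega> = (\<lambda>I v. 0)}"

definition coboundaries where
  "coboundaries m a l k = (if k = 0 then {(\<lambda>I v. 0)} else nabla m a l ` cochains m a (k - 1))"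

definition lincomb :: "('c \<Rightarrow> ratfun) \<Rightarrow> 'c set \<Rightarrow> ('c \<Rightarrow> 'b \<Rightarrow> 'd \<Rightarrow> ratfun) \<Rightarrow> 'b \<Rightarrow> 'd \<Rightarrow> ratfun" where
  "lincomb c W f = (\<lambda>J u. \<Sum>w\<in>W. c w * f w J u)"

definition quotient_dim_is :: "('b \<Rightarrow> 'd \<Rightarrow> ratfun) set \<Rightarrow> ('b \<Rightarrow> 'd \<Rightarrow> ratfun) set \<Rightarrow> nat \<Rightarrow> bool" where
  "quotient_dim_is Z Bd d \<longleftrightarrow> (\<exists>W. finite W \<and> card W = d \<and> W \<subseteq> Z \<and>
      (\<forall>c. lincomb c W id \<in> Bd \<longrightarrow> (\<forall>w\<in>W. c w = 0)) \<and>
      (\<forall>z\<in>Z. \<exists>c b. b \<in> Bd \<and> z = (\<lambda>J u. lincomb c W id J u + b J u)))"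

end

(* Write nabla = nabla_0 + E - lambda N, where nabla_0 is wedging with sum_j l_j x^(a_j) e_j and E is
   diagonal in the monomials.  For nabla_0 there is an explicit contracting homotopy h: on a basis
   element x^u e_J take the first index j for which j in J and u'_j < 1 fails, and if j lies in J
   divide by l_j x^(a_j) e_j.  It contracts everything except the span of the x^b e_1...e_m with
   b in P(A) having all coordinates positive.  Let pi be the projection onto this span and
   U = nabla h + h nabla + pi = 1 + (terms lowering deg u - |J|) + lambda (terms preserving it).
   Divisibility by powers of lambda shows that U is injective, hence bijective on the finite-dimensional
   filtered pieces.  As U preserves cocycles, every cocycle below the top degree has the form
   U z = nabla h z, and in degree m the monomials x^b e_1...e_m form a basis of the cohomology.
   Inclusion-exclusion over the supports counts these b. *)

theory Submission
  imports Defs "HOL-Computational_Algebra.Polynomial_Factorial" "HOL-Library.Function_Algebras"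
begin

text \<open>All of x^(a_1), ..., x^(a_m) and x^(a_0) have degree 1, the last because l_0 is the sum
  of the l_j. So nabla_0, N and h keep deg u - |J|, while E, which adds an e_j without moving the
  monomial, lowers it by 1. The E terms of U alone would be nilpotent on a filtered piece, but the
  lambda terms stay on the same level, so the Neumann series for the inverse of U need not terminate
  and would require completing in lambda. Injectivity with a dimension count avoids the completion.
  The homotopy h is that of a tensor product. On a class of M modulo the lattice of a_1, ..., a_m,
  the complex of nabla_0 is, up to the factors l_j, a tensor product of two-term complexes, one for
  each j: the shift t -> t + 1 of the j-th coordinate, from t >= 0 (j not in J) to t > 0 (j in J).
  It is injective and misses only 0 < t < 1, which leaves the interior points b. Acting at the first
  index not already in such a missed position combines the homotopies of the factors.\<close>

section \<open>Linear algebra and lambda-adic divisibility\<close>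

text \<open>The space of all cochains is infinite-dimensional, so finite dimension enters only
  through the finite set X whose span contains Z. The image of a basis of Z is independent and has
  the same cardinality, so it must span Z.\<close>

lemma (in vector_space) inj_on_endo_surj:
  assumes lin: "Vector_Spaces.linear scale scale f"
    and Z: "subspace Z" "Z \<subseteq> span X" "finite X"
    and maps: "f ` Z \<subseteq> Z" and inj: "inj_on f Z"
  shows "Z \<subseteq> f ` Z"
proof
  fix z assume z: "z \<in> Z"
  interpret p: vector_space_pair scale scale ..
  obtain B where B: "B \<subseteq> Z" "independent B" "Z \<subseteq> span B"
    by (rule maximal_independent_subset)
  have spB: "span B = Z"
    using B Z(1) by (simp add: span_subspace)
  have finB: "finite B"
    using independent_span_bound[OF Z(3) B(2)] B(1) Z(2) by auto
  have ind: "independent (f ` B)"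
    by (rule p.linear_independent_injective_image[OF lin B(2)]) (simp add: spB inj)
  have cB: "card (f ` B) = card B"
    using inj B(1) by (meson card_image inj_on_subset)
  have fB: "f ` B \<subseteq> Z" using B(1) maps by blast
  have "z \<in> span (f ` B)"
  proof (rule ccontr)
    assume nz: "z \<notin> span (f ` B)"
    then have "independent (insert z (f ` B))"
      using ind by (simp add: independent_insertI)
    moreover have "insert z (f ` B) \<subseteq> span B" using z fB spB by auto
    ultimately have "card (insert z (f ` B)) \<le> card B"
      using independent_span_bound[OF finB] by blast
    moreover have "z \<notin> f ` B" using nz span_base by blast
    ultimately show False using finB cB by simp
  qed
  also have "span (f ` B) = f ` span B"
    by (rule p.linear_span_image[OF lin])
  finally show "z \<in> f ` Z" using spB by simp
qed

text \<open>The ring identity behind \<open>Dt_commute\<close>: \<open>ci\<close> and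
  \<open>cj\<close> are coordinates of an exponent v, \<open>ri\<close> and \<open>rj\<close> those
  of a_0, and the remaining variables are coefficients at shifts of v. The assumption says that the
  coordinates of a_0 are proportional to the l_j; it matches the two terms caused by the shift from
  v to v - a_0.\<close>

lemma twisted_commutator:
  fixes ci :: "'a::comm_ring_1"
  assumes "lj * ri = li * rj"
  shows "ci * (cj * x + lj * y - lj * L * z) + li * (cj * p + lj * q - lj * L * s)
        - li * L * ((cj - rj) * z + lj * t - lj * L * w)
      = cj * (ci * x + li * p - li * L * z) + lj * (ci * y + li * q - li * L * t)
        - lj * L * ((ci - ri) * z + li * s - li * L * w)"
proof -
  have "li * L * (rj * z) = lj * L * (ri * z)"
    using arg_cong[OF assms, of "\<lambda>t. t * (L * z)"] by (simp add: ac_simps)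
  then show ?thesis by (simp add: algebra_simps)
qed

text \<open>Padding the diagonal with zeros gives a sum over a square, which the exchange of the two
  indices negates.\<close>

lemma antisym_double_sum:
  fixes F :: "'i \<Rightarrow> 'i \<Rightarrow> 'a::idom"
  assumes fin: "finite I" and two: "(1 + 1 :: 'a) \<noteq> 0"
    and anti: "\<And>i j. i \<in> I \<Longrightarrow> j \<in> I \<Longrightarrow> i \<noteq> j \<Longrightarrow> F j i = - F i j"
  shows "(\<Sum>j\<in>I. \<Sum>i\<in>I - {j}. F j i) = 0"
proof -
  define G where "G j i = (if i = j then 0 else F j i)" for j i
  have "G j i = - G i j" if "i \<in> I" "j \<in> I" for i j
    using anti[OF that] by (cases "i = j") (simp_all add: G_def)
  then have "(\<Sum>j\<in>I. \<Sum>i\<in>I. G j i) = (\<Sum>j\<in>I. \<Sum>i\<in>I. - G i j)"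
    by (intro sum.cong refl)
  also have "\<dots> = - (\<Sum>j\<in>I. \<Sum>i\<in>I. G j i)"
    by (subst sum.swap) (simp add: sum_negf)
  finally have "(1 + 1) * (\<Sum>j\<in>I. \<Sum>i\<in>I. G j i) = 0"
    by (simp add: distrib_right eq_neg_iff_add_eq_0)
  moreover have "(\<Sum>j\<in>I. \<Sum>i\<in>I - {j}. F j i) = (\<Sum>j\<in>I. \<Sum>i\<in>I. G j i)"
    using fin by (intro sum.cong refl sum.mono_neutral_cong_left) (auto simp: G_def)
  ultimately show ?thesis using two by simp
qed

lemma ratfun_two_neq_0: "(1 + 1 :: ratfun) \<noteq> 0"
proof
  assume "(1 + 1 :: ratfun) = 0"
  then have "to_fract (1 + 1 :: complex poly) = 0" by (simp only: to_fract_add to_fract_1)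
  then show False by simp
qed

section \<open>Divisibility by powers of lambda\<close>

text \<open>Divisibility is taken in the polynomial ring, since in the field of rational functions
  it would be vacuous. In particular \<open>lam_dvd 0 x\<close> says that x is a polynomial.\<close>

definition lam_dvd :: "nat \<Rightarrow> ratfun \<Rightarrow> bool" where
  "lam_dvd r x \<longleftrightarrow> (\<exists>p. x = to_fract ([:0, 1:] ^ r * p))"

lemma lam_conv: "lam = to_fract [:0, 1:]"
  by (simp add: lam_def to_fract_def)

lemma cst_conv: "cst c = to_fract [:c:]"
  by (simp add: cst_def to_fract_def)

lemma cst_0 [simp]: "cst 0 = 0"
  by (simp add: cst_conv)

lemma cst_add: "cst (c + d) = cst c + cst d"
  by (simp add: cst_conv flip: to_fract_add)

lemma cst_diff: "cst (c - d) = cst c - cst d"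
  by (simp add: cst_conv flip: to_fract_diff)

lemma cst_of_nat: "cst (of_nat n) = of_nat n"
  by (induction n) (simp_all add: cst_add, simp_all add: cst_conv flip: one_pCons)

lemma cst_mult: "cst (c * d) = cst c * cst d"
  by (simp add: cst_conv mult.commute flip: to_fract_mult)

lemma lam_dvd_0 [simp]: "lam_dvd r 0"
  unfolding lam_dvd_def by (rule exI[of _ 0]) simp

lemma lam_dvd_add: "lam_dvd r x \<Longrightarrow> lam_dvd r y \<Longrightarrow> lam_dvd r (x + y)"
  unfolding lam_dvd_def by (metis distrib_left to_fract_add)

lemma lam_dvd_uminus: "lam_dvd r x \<Longrightarrow> lam_dvd r (- x)"
  unfolding lam_dvd_def by (metis mult_minus_right to_fract_uminus)

lemma lam_dvd_sum: "(\<And>i. i \<in> A \<Longrightarrow> lam_dvd r (f i)) \<Longrightarrow> lam_dvd r (sum f A)"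
  by (induction A rule: infinite_finite_induct) (auto intro: lam_dvd_add)

lemma lam_dvd_cst_mult: "lam_dvd r x \<Longrightarrow> lam_dvd r (cst c * x)"
  unfolding lam_dvd_def cst_conv by (metis mult.left_commute to_fract_mult)

lemma lam_dvd_of_nat_mult: "lam_dvd r x \<Longrightarrow> lam_dvd r (of_nat n * x)"
  by (metis lam_dvd_cst_mult cst_of_nat)

lemma lam_dvd_sign_mult: "lam_dvd r x \<Longrightarrow> lam_dvd r ((- 1) ^ n * x)"
  by (cases "even n") (auto intro: lam_dvd_uminus)

text \<open>The homotopy divides by the l_j. These are units among the constants, so no power of
  lambda is lost.\<close>

lemma lam_dvd_inverse_of_nat_mult:
  assumes "lam_dvd r x" shows "lam_dvd r (inverse (of_nat n) * x)"
proof -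
  have "inverse (of_nat n :: ratfun) = cst (inverse (of_nat n))"
  proof (cases "n = 0")
    case False
    have "cst (inverse (of_nat n)) * of_nat n = cst (inverse (of_nat n) * of_nat n)"
      by (simp only: cst_mult cst_of_nat)
    also have "\<dots> = 1" using False by (simp add: cst_conv flip: one_pCons)
    finally show ?thesis by (metis inverse_unique mult.commute)
  qed simp
  then show ?thesis using assms lam_dvd_cst_mult by simp
qed

lemma lam_dvd_lam_mult: "lam_dvd r x \<Longrightarrow> lam_dvd (Suc r) (lam * x)"
  unfolding lam_dvd_def lam_conv by (metis mult.assoc power_Suc to_fract_mult)

text \<open>The power of lambda with exponent one more than the degree cannot divide a nonzero
  polynomial.\<close>

lemma lam_dvd_all_imp_0:
  assumes "\<And>r. lam_dvd r x" shows "x = 0"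
proof -
  obtain p where p: "x = to_fract p"
    using assms[of 0] by (auto simp: lam_dvd_def)
  have "[:0, 1:] ^ r dvd p" for r
    using assms[of r] p by (auto simp: lam_dvd_def simp del: to_fract_mult)
  then have "p = 0 \<or> Suc (degree p) \<le> degree p"
    using dvd_imp_degree_le[of "[:0, 1:] ^ Suc (degree p)" p]
    by (metis degree_linear_power linorder_not_less)
  then show ?thesis using p by simp
qed

text \<open>Provides the start of the divisibility induction in \<open>U_kernel\<close>: a nonzero
  scalar multiple of a cochain has polynomial coefficients and lies in the kernel of U along with
  it.\<close>

lemma common_denominator:
  assumes "finite X"
  shows "\<exists>q::complex poly. q \<noteq> 0 \<and> (\<forall>x\<in>X. lam_dvd 0 (to_fract q * x))"
  using assms
proof (induction X)
  case empty
  show ?case by (rule exI[of _ 1]) simp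
next
  case (insert x X)
  then obtain q where q: "q \<noteq> 0" "\<forall>x\<in>X. lam_dvd 0 (to_fract q * x)" by blast
  obtain a b where x: "x = Fraction_Field.Fract a b" "b \<noteq> 0" by (cases x) auto
  have "lam_dvd 0 (to_fract (q * b) * x)"
    using x unfolding lam_dvd_def
    by (intro exI[of _ "q * a"]) (simp add: Fract_conv_to_fract)
  moreover have "lam_dvd 0 (to_fract (q * b) * y)" if y: "y \<in> X" for y
  proof -
    obtain p where "to_fract q * y = to_fract p"
      using q(2) y by (auto simp: lam_dvd_def)
    then have "to_fract (q * b) * y = to_fract (p * b)"
      by (simp add: algebra_simps)
    then show ?thesis unfolding lam_dvd_def power_0 mult_1_left by blast
  qed
  ultimately show ?case
    using q(1) x(2) by (intro exI[of _ "q * b"]) auto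
qed

interpretation cochain_space: vector_space
  "\<lambda>(c::ratfun) (\<omega> :: nat set \<Rightarrow> ('n \<Rightarrow> int) \<Rightarrow> ratfun) J u. c * \<omega> J u"
  by unfold_locales (auto simp: fun_eq_iff algebra_simps)

section \<open>Coordinates with respect to the basis\<close>

locale dwork_data =
  fixes m :: nat and a :: "nat \<Rightarrow> 'n::finite \<Rightarrow> int" and l :: "nat \<Rightarrow> nat"
  assumes lin_indep: "\<And>c :: nat \<Rightarrow> real.
      (\<forall>i. (\<Sum>j\<in>{1..m}. c j * real_of_int (a j i)) = 0) \<Longrightarrow> \<forall>j\<in>{1..m}. c j = 0"
    and l_pos: "\<forall>j\<in>{0..m}. l j > 0"
    and rel: "\<forall>i. int (l 0) * a 0 i = (\<Sum>j\<in>{1..m}. int (l j) * a j i)"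
    and l0: "l 0 = (\<Sum>j\<in>{1..m}. l j)"
begin

abbreviation "V \<equiv> VZ m a"
abbreviation "M \<equiv> Mset m a"
abbreviation "cs \<equiv> coords m a"

definition deg :: "('n \<Rightarrow> int) \<Rightarrow> real" where
  "deg u = (\<Sum>j\<in>{1..m}. cs u j)"

lemma is_coords_unique:
  assumes "is_coords m a u c" "is_coords m a u d"
  shows "c = d"
proof
  fix j
  have "\<forall>i. (\<Sum>j\<in>{1..m}. (c j - d j) * real_of_int (a j i)) = 0"
  proof
    fix i
    show "(\<Sum>j\<in>{1..m}. (c j - d j) * real_of_int (a j i)) = 0"
      using assms unfolding is_coords_def left_diff_distrib sum_subtractf by simp
  qed
  from lin_indep[OF this] show "c j = d j"
    using assms by (cases "j \<in> {1..m}") (auto simp: is_coords_def)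
qed

lemma coords_eqI: "is_coords m a u c \<Longrightarrow> cs u = c"
  unfolding coords_def using is_coords_unique by (intro the_equality) auto

lemma VZ_I: "is_coords m a u c \<Longrightarrow> u \<in> V"
  by (auto simp: VZ_def)

lemma is_coords_coords: "u \<in> V \<Longrightarrow> is_coords m a u (cs u)"
  using coords_eqI by (auto simp: VZ_def)

lemma coords_outside: "u \<in> V \<Longrightarrow> j \<notin> {1..m} \<Longrightarrow> cs u j = 0"
  using is_coords_coords by (auto simp: is_coords_def)

lemma in_cone_iff:
  "in_cone m a T u \<longleftrightarrow> u \<in> V \<and> (\<forall>j. 0 \<le> cs u j) \<and> (\<forall>j. j \<notin> T \<longrightarrow> cs u j = 0)"
  unfolding in_cone_def using coords_eqI is_coords_coords VZ_I by blast

lemma M_iff: "u \<in> M \<longleftrightarrow> u \<in> V \<and> (\<forall>j. 0 \<le> cs u j)"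
  using coords_outside by (auto simp: Mset_def in_cone_iff)

lemma M_V: "u \<in> M \<Longrightarrow> u \<in> V"
  by (simp add: M_iff)

lemma M_nonneg: "u \<in> M \<Longrightarrow> 0 \<le> cs u j"
  by (simp add: M_iff)

lemma calB_iff: "u \<in> calB m a \<longleftrightarrow> u \<in> V \<and> (\<forall>j\<in>{1..m}. 0 \<le> cs u j \<and> cs u j < 1)"
  unfolding calB_def using coords_eqI is_coords_coords VZ_I by blast

lemma is_coords_add:
  assumes "is_coords m a u c" "is_coords m a v d"
  shows "is_coords m a (u + v) (\<lambda>j. c j + d j)"
  using assms by (auto simp: is_coords_def distrib_right sum.distrib)

lemma is_coords_diff:
  assumes "is_coords m a u c" "is_coords m a v d"
  shows "is_coords m a (u - v) (\<lambda>j. c j - d j)"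
  using assms by (auto simp: is_coords_def left_diff_distrib sum_subtractf)

lemma V_add: "u \<in> V \<Longrightarrow> v \<in> V \<Longrightarrow> u + v \<in> V"
  and coords_add: "u \<in> V \<Longrightarrow> v \<in> V \<Longrightarrow> cs (u + v) = (\<lambda>j. cs u j + cs v j)"
  using is_coords_add[OF is_coords_coords is_coords_coords] by (blast intro: VZ_I coords_eqI)+

lemma V_diff: "u \<in> V \<Longrightarrow> v \<in> V \<Longrightarrow> u - v \<in> V"
  and coords_diff: "u \<in> V \<Longrightarrow> v \<in> V \<Longrightarrow> cs (u - v) = (\<lambda>j. cs u j - cs v j)"
  using is_coords_diff[OF is_coords_coords is_coords_coords] by (blast intro: VZ_I coords_eqI)+

lemma is_coords_a:
  assumes "j \<in> {1..m}"
  shows "is_coords m a (a j) (\<lambda>i. if i = j then 1 else 0)"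
proof -
  have "(\<Sum>k\<in>{1..m}. (if k = j then 1 else 0) * real_of_int (a k i)) = real_of_int (a j i)" for i
  proof -
    have "(\<Sum>k\<in>{1..m}. (if k = j then 1 else 0) * real_of_int (a k i))
        = (\<Sum>k\<in>{1..m}. if k = j then real_of_int (a k i) else 0)"
      by (intro sum.cong) auto
    then show ?thesis using assms by simp
  qed
  then show ?thesis using assms by (auto simp: is_coords_def)
qed

lemma is_coords_a0: "is_coords m a (a 0) (\<lambda>i. if i \<in> {1..m} then real (l i) / real (l 0) else 0)"
proof -
  have "real_of_int (a 0 i)
      = (\<Sum>j\<in>{1..m}. (if j \<in> {1..m} then real (l j) / real (l 0) else 0) * real_of_int (a j i))" for i
  proof -
    have "real (l 0) * real_of_int (a 0 i) = real_of_int (int (l 0) * a 0 i)" by simp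
    also have "\<dots> = (\<Sum>j\<in>{1..m}. real (l j) * real_of_int (a j i))"
      unfolding rel[rule_format] by simp
    finally have "real_of_int (a 0 i) = (\<Sum>j\<in>{1..m}. real (l j) * real_of_int (a j i)) / real (l 0)"
      using l_pos by (simp add: field_simps)
    also have "\<dots> = (\<Sum>j\<in>{1..m}. (if j \<in> {1..m} then real (l j) / real (l 0) else 0) * real_of_int (a j i))"
      unfolding sum_divide_distrib by (intro sum.cong) auto
    finally show ?thesis .
  qed
  then show ?thesis by (auto simp: is_coords_def)
qed

lemma a_V: "j \<le> m \<Longrightarrow> a j \<in> V"
  using is_coords_a[of j] is_coords_a0 VZ_I by (cases "j = 0") auto

lemma coords_a: "j \<in> {1..m} \<Longrightarrow> cs (a j) = (\<lambda>i. if i = j then 1 else 0)"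
  using is_coords_a coords_eqI by blast

lemma coords_a0: "cs (a 0) = (\<lambda>i. if i \<in> {1..m} then real (l i) / real (l 0) else 0)"
  using is_coords_a0 coords_eqI by blast

lemma coords_add_a: "v \<in> V \<Longrightarrow> j \<in> {1..m} \<Longrightarrow> cs (v + a j) i = cs v i + (if i = j then 1 else 0)"
  by (simp add: coords_add a_V coords_a)

lemma coords_diff_a: "v \<in> V \<Longrightarrow> j \<in> {1..m} \<Longrightarrow> cs (v - a j) i = cs v i - (if i = j then 1 else 0)"
  by (simp add: coords_diff a_V coords_a)

lemma V_diff_a: "j \<le> m \<Longrightarrow> v - a j \<in> V \<longleftrightarrow> v \<in> V"
  using V_add[of "v - a j" "a j"] V_diff a_V by auto

lemma deg_add_a: "v \<in> V \<Longrightarrow> j \<in> {1..m} \<Longrightarrow> deg (v + a j) = deg v + 1"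
  by (simp add: deg_def coords_add_a sum.distrib)

lemma deg_diff_a: "v \<in> V \<Longrightarrow> j \<in> {1..m} \<Longrightarrow> deg (v - a j) = deg v - 1"
  by (simp add: deg_def coords_diff_a sum_subtractf)

text \<open>The coordinates of a_0 are l_j / l_0, and they add up to 1 because l_0 is the sum of the
  l_j.\<close>

lemma deg_diff_a0: "v \<in> V \<Longrightarrow> deg (v - a 0) = deg v - 1"
proof -
  assume v: "v \<in> V"
  have "(\<Sum>j\<in>{1..m}. real (l j) / real (l 0)) = 1"
  proof -
    have "(\<Sum>j\<in>{1..m}. real (l j) / real (l 0)) = real (l 0) / real (l 0)"
      by (subst (2) l0) (simp add: sum_divide_distrib)
    then show ?thesis using l_pos by simp
  qed
  then show ?thesis
    using v by (simp add: deg_def coords_diff a_V coords_a0 sum_subtractf)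
qed

lemma coords_a0_pos: "j \<in> {1..m} \<Longrightarrow> 0 < cs (a 0) j"
  using l_pos by (simp add: coords_a0)

lemma coords_a0_nonneg: "0 \<le> cs (a 0) j"
  by (simp add: coords_a0)

text \<open>Coordinates of points of M are nonnegative, so each of them is at most the degree. This
  bounds the integer entries of u, and a box contains only finitely many integer vectors.\<close>

lemma finite_M_deg_le: "finite {u \<in> M. deg u \<le> D}"
proof -
  define b where "b i = \<lceil>\<Sum>j\<in>{1..m}. D * \<bar>real_of_int (a j i)\<bar>\<rceil>" for i
  define N where "N = Max (range b)"
  have "{u \<in> M. deg u \<le> D} \<subseteq> {f. \<forall>x. (x \<in> UNIV \<longrightarrow> f x \<in> {- N..N}) \<and> (x \<notin> UNIV \<longrightarrow> f x = 0)}"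
  proof safe
    fix u i assume u: "u \<in> M" "deg u \<le> D"
    have c: "0 \<le> cs u j" "cs u j \<le> D" if "j \<in> {1..m}" for j
    proof -
      show "0 \<le> cs u j" using u M_nonneg by auto
      have "cs u j \<le> deg u" unfolding deg_def
        by (rule member_le_sum) (use that u M_nonneg in auto)
      then show "cs u j \<le> D" using u by simp
    qed
    have "\<bar>real_of_int (u i)\<bar> = \<bar>\<Sum>j\<in>{1..m}. cs u j * real_of_int (a j i)\<bar>"
      using is_coords_coords[OF M_V[OF u(1)]] by (simp add: is_coords_def)
    also have "\<dots> \<le> (\<Sum>j\<in>{1..m}. \<bar>cs u j * real_of_int (a j i)\<bar>)" by (rule sum_abs)
    also have "\<dots> \<le> (\<Sum>j\<in>{1..m}. D * \<bar>real_of_int (a j i)\<bar>)"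
      by (intro sum_mono) (use c in \<open>auto simp: abs_mult intro!: mult_right_mono\<close>)
    also have "\<dots> \<le> b i" by (simp add: b_def)
    also have "\<dots> \<le> N" by (simp add: N_def)
    finally have "\<bar>u i\<bar> \<le> N" by linarith
    then show "u i \<in> {- N..N}" by auto
  qed auto
  then show ?thesis
    by (rule finite_subset) (intro finite_set_of_finite_funs; simp)
qed

lemma finite_calB: "finite (calB m a)"
proof (rule finite_subset[OF _ finite_M_deg_le])
  show "calB m a \<subseteq> {u \<in> M. deg u \<le> real m}"
  proof safe
    fix u assume u: "u \<in> calB m a"
    show "u \<in> M" unfolding M_iff
      using u coords_outside[of u] by (metis calB_iff order_refl)
    have "deg u \<le> (\<Sum>j\<in>{1..m}. 1)"
      unfolding deg_def by (intro sum_mono) (use u calB_iff in force)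
    then show "deg u \<le> real m" by simp
  qed
qed

section \<open>The filtered complex\<close>

definition lev :: "nat set \<Rightarrow> ('n \<Rightarrow> int) \<Rightarrow> real" where
  "lev J u = deg u - real (card J)"

text \<open>A pair (J, u) stands for the basis element x^u e_J; positivity on J is the condition
  defining S'_{A,J}.\<close>

definition cells :: "nat \<Rightarrow> real \<Rightarrow> (nat set \<times> ('n \<Rightarrow> int)) set" where
  "cells k D = {(J, u). J \<subseteq> {1..m} \<and> card J = k \<and> u \<in> M \<and> (\<forall>j\<in>J. 0 < cs u j) \<and> lev J u \<le> D}"

text \<open>Finite support is automatic here, because \<open>cells k D\<close> is finite.\<close>

definition filt :: "nat \<Rightarrow> real \<Rightarrow> (nat set \<Rightarrow> ('n \<Rightarrow> int) \<Rightarrow> ratfun) set" where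
  "filt k D = {\<omega>. \<forall>J u. \<omega> J u \<noteq> 0 \<longrightarrow> (J, u) \<in> cells k D}"

lemma finite_cells: "finite (cells k D)"
proof (rule finite_subset)
  show "cells k D \<subseteq> Pow {1..m} \<times> {u \<in> M. deg u \<le> D + real k}"
    by (auto simp: cells_def lev_def)
qed (auto intro: finite_M_deg_le)

lemma Sp_iff:
  "\<xi> \<in> Sp m a T \<longleftrightarrow>
    finite {u. \<xi> u \<noteq> 0} \<and> (\<forall>u. \<xi> u \<noteq> 0 \<longrightarrow> u \<in> M \<and> (\<forall>j\<in>T. 0 < cs u j))"
  by (simp only: Sp_def mem_Collect_eq)

lemma cochainsD:
  assumes "\<omega> \<in> cochains m a k"
  shows "\<omega> J u \<noteq> 0 \<Longrightarrow> J \<subseteq> {1..m} \<and> card J = k \<and> u \<in> M \<and> (\<forall>j\<in>J. 0 < cs u j)"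
    and "finite {u. \<omega> J u \<noteq> 0}"
proof -
  have 1: "\<omega> J \<in> Sp m a J" if "J \<subseteq> {1..m} \<and> card J = k"
    using assms that unfolding cochains_def mem_Collect_eq by metis
  have 2: "\<omega> J = (\<lambda>u. 0)" if "\<not> (J \<subseteq> {1..m} \<and> card J = k)"
    using assms that unfolding cochains_def mem_Collect_eq by metis
  show "finite {u. \<omega> J u \<noteq> 0}"
  proof (cases "J \<subseteq> {1..m} \<and> card J = k")
    case True
    from 1[OF this] show ?thesis by (simp only: Sp_iff)
  next
    case False
    from 2[OF this] show ?thesis by simp
  qed
  show "J \<subseteq> {1..m} \<and> card J = k \<and> u \<in> M \<and> (\<forall>j\<in>J. 0 < cs u j)" if nz: "\<omega> J u \<noteq> 0"
  proof (cases "J \<subseteq> {1..m} \<and> card J = k")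
    case True
    with 1[OF True] nz show ?thesis unfolding Sp_iff by metis
  next
    case False
    from 2[OF this] nz show ?thesis by simp
  qed
qed

lemma filtD:
  assumes "\<omega> \<in> filt k D" "\<omega> J u \<noteq> 0"
  shows "J \<subseteq> {1..m}" "card J = k" "u \<in> M" "u \<in> V" "\<And>j. j \<in> J \<Longrightarrow> 0 < cs u j" "lev J u \<le> D"
proof -
  have "(J, u) \<in> cells k D" using assms unfolding filt_def mem_Collect_eq by metis
  then show "J \<subseteq> {1..m}" "card J = k" "u \<in> M" "u \<in> V" "\<And>j. j \<in> J \<Longrightarrow> 0 < cs u j" "lev J u \<le> D"
    unfolding cells_def mem_Collect_eq prod.case using M_V by blast+
qed

lemma filtI:
  assumes "\<And>J u. \<omega> J u \<noteq> 0 \<Longrightarrow>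
    J \<subseteq> {1..m} \<and> card J = k \<and> u \<in> M \<and> (\<forall>j\<in>J. 0 < cs u j) \<and> lev J u \<le> D"
  shows "\<omega> \<in> filt k D"
  unfolding filt_def cells_def mem_Collect_eq prod.case using assms by metis

text \<open>A cochain involves finitely many monomials, so its level is bounded. Every single
  cochain thus lies in a finite-dimensional space on which U can be inverted.\<close>

lemma cochains_imp_filt:
  assumes \<omega>: "\<omega> \<in> cochains m a k"
  shows "\<exists>D. \<omega> \<in> filt k D"
proof -
  let ?S = "SIGMA J : Pow {1..m}. {u. \<omega> J u \<noteq> 0}"
  have "finite ?S" using cochainsD(2)[OF \<omega>] by (intro finite_SigmaI) simp_all
  then have fin: "finite ((\<lambda>(J, u). lev J u) ` ?S)" by (rule finite_imageI)
  \<comment> \<open>For the zero cochain this is \<open>Max\<close> of the empty set, an unspecified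
    number; membership in \<open>filt\<close> is then vacuous.\<close>
  have "\<omega> \<in> filt k (Max ((\<lambda>(J, u). lev J u) ` ?S))"
  proof (rule filtI)
    fix J u assume h: "\<omega> J u \<noteq> 0"
    note n = cochainsD(1)[OF \<omega> h]
    have "(J, u) \<in> ?S" using n h by blast
    then have "lev J u \<le> Max ((\<lambda>(J, u). lev J u) ` ?S)"
      by (intro Max_ge[OF fin] image_eqI[where x = "(J, u)"]) (simp only: prod.case)
    with n show "J \<subseteq> {1..m} \<and> card J = k \<and> u \<in> M \<and> (\<forall>j\<in>J. 0 < cs u j)
        \<and> lev J u \<le> Max ((\<lambda>(J, u). lev J u) ` ?S)" by blast
  qed
  then show ?thesis ..
qed

lemma filt_imp_cochains:
  assumes \<omega>: "\<omega> \<in> filt k D"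
  shows "\<omega> \<in> cochains m a k"
proof -
  have fin: "finite {u. \<omega> J u \<noteq> 0}" for J
  proof (rule finite_subset[OF _ finite_imageI[OF finite_cells[of k D], of snd]])
    show "{u. \<omega> J u \<noteq> 0} \<subseteq> snd ` cells k D"
    proof
      fix x assume "x \<in> {u. \<omega> J u \<noteq> 0}"
      then have "(J, x) \<in> cells k D" using \<omega> unfolding filt_def by blast
      then show "x \<in> snd ` cells k D" by (rule image_eqI[rotated]) simp
    qed
  qed
  show ?thesis
    unfolding cochains_def mem_Collect_eq
  proof (intro allI conjI impI)
    fix J
    show "\<omega> J \<in> Sp m a J"
      unfolding Sp_iff using fin filtD(3,5)[OF \<omega>] by blast
    show "\<omega> J = (\<lambda>u. 0)" if "\<not> (J \<subseteq> {1..m} \<and> card J = k)"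
      using filtD(1,2)[OF \<omega>] that by blast
  qed
qed

(* Otherwise eta-expanded exponent vectors v - a j are rewritten pointwise and the rules for coords no longer match. *)
declare minus_apply [simp del]

lemma filt_0: "0 \<in> filt k D"
  by (simp add: filt_def)

lemma filt_add: "\<omega> \<in> filt k D \<Longrightarrow> \<eta> \<in> filt k D \<Longrightarrow> \<omega> + \<eta> \<in> filt k D"
  by (auto simp: filt_def) (metis add.right_neutral)

lemma filt_scale: "\<omega> \<in> filt k D \<Longrightarrow> (\<lambda>J u. c * \<omega> J u) \<in> filt k D"
  by (auto simp: filt_def)

lemma subspace_filt: "cochain_space.subspace (filt k D)"
  unfolding cochain_space.subspace_def using filt_0 filt_add filt_scale by blast

lemma sum_fun_apply2:
  fixes f :: "'i \<Rightarrow> 'a \<Rightarrow> 'b \<Rightarrow> 'c::comm_monoid_add"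
  shows "(\<Sum>p\<in>S. f p) x y = (\<Sum>p\<in>S. f p x y)"
  by (induction S rule: infinite_finite_induct) simp_all

lemma filt_spanned: "\<exists>X. finite X \<and> filt k D \<subseteq> cochain_space.span X"
proof -
  define \<delta> :: "nat set \<times> ('n \<Rightarrow> int) \<Rightarrow> nat set \<Rightarrow> ('n \<Rightarrow> int) \<Rightarrow> ratfun"
    where "\<delta> p J u = (if (J, u) = p then 1 else 0)" for p J u
  let ?X = "\<delta> ` cells k D"
  have "\<omega> \<in> cochain_space.span ?X" if \<omega>: "\<omega> \<in> filt k D" for \<omega>
  proof -
    have "\<omega> = (\<Sum>p\<in>cells k D. (\<lambda>J u. \<omega> (fst p) (snd p) * \<delta> p J u))"
    proof (intro ext)
      fix J u
      have "(\<Sum>p\<in>cells k D. \<omega> (fst p) (snd p) * \<delta> p J u)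
          = (\<Sum>p\<in>cells k D. if (J, u) = p then \<omega> J u else 0)"
        by (intro sum.cong refl) (auto simp: \<delta>_def)
      also have "\<dots> = (if (J, u) \<in> cells k D then \<omega> J u else 0)"
        using finite_cells by simp
      also have "\<dots> = \<omega> J u"
        using \<omega> by (auto simp: filt_def)
      finally show "\<omega> J u = (\<Sum>p\<in>cells k D. (\<lambda>J u. \<omega> (fst p) (snd p) * \<delta> p J u)) J u"
        by (simp only: sum_fun_apply2)
    qed
    also have "\<dots> \<in> cochain_space.span ?X"
      by (intro cochain_space.span_sum cochain_space.span_scale cochain_space.span_base imageI)
    finally show ?thesis .
  qed
  then show ?thesis using finite_cells by blast
qed

section \<open>The differential and its compatibility with the filtration\<close>

abbreviation "grad \<equiv> nabla m a l"

text \<open>Only indices below j are counted, so the sign is the same whether or not j belongs to I.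
  This allows one function to serve both the differential, where j is in I, and the homotopy, where
  it is not.\<close>

definition sg :: "nat set \<Rightarrow> nat \<Rightarrow> ratfun" where
  "sg I j = (- 1) ^ card {i\<in>I. i < j}"

lemma sg_sq: "sg I j * sg I j = 1"
  by (simp add: sg_def flip: power_add mult_2)

lemma sg_insert_less:
  assumes "finite I" "f \<notin> I" "f < j" shows "sg (insert f I) j = - sg I j"
proof -
  have "{i \<in> insert f I. i < j} = insert f {i\<in>I. i < j}" using assms by auto
  then show ?thesis using assms by (simp add: sg_def)
qed

lemma sg_insert_ge:
  assumes "j \<le> f" shows "sg (insert f I) j = sg I j"
proof -
  have "{i \<in> insert f I. i < j} = {i\<in>I. i < j}" using assms by auto
  then show ?thesis by (simp add: sg_def)
qed

lemma sg_remove_less: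
  assumes "finite I" "f \<in> I" "f < j" shows "sg (I - {f}) j = - sg I j"
  using sg_insert_less[of "I - {f}" f j] assms by (simp add: insert_absorb)

lemma sg_remove_ge:
  assumes "j \<le> f" shows "sg (I - {f}) j = sg I j"
  using sg_insert_ge[OF assms, of "I - {f}"] sg_insert_ge[OF assms, of I]
  by (metis insert_Diff_single)

text \<open>\<open>Dtil\<close> with shifted exponents written as \<open>v - a j\<close>, the form
  to which the coordinate lemmas apply.\<close>

definition Dt :: "nat \<Rightarrow> (('n \<Rightarrow> int) \<Rightarrow> ratfun) \<Rightarrow> ('n \<Rightarrow> int) \<Rightarrow> ratfun" where
  "Dt j \<xi> v = cst (complex_of_real (cs v j)) * \<xi> v
     + of_nat (l j) * \<xi> (v - a j) - of_nat (l j) * lam * \<xi> (v - a 0)"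

lemma Dtil_eq: "Dtil m a l j \<xi> = Dt j \<xi>"
  by (simp add: Dtil_def Dt_def fun_eq_iff fun_diff_def)

lemma grad_apply:
  "grad \<omega> I v = (if I \<subseteq> {1..m} then \<Sum>j\<in>I. sg I j * Dt j (\<omega> (I - {j})) v else 0)"
  by (simp add: nabla_def sg_def Dtil_eq)

lemma Dt_add: "Dt j (\<lambda>u. \<xi> u + \<eta> u) v = Dt j \<xi> v + Dt j \<eta> v"
  by (simp add: Dt_def algebra_simps)

lemma Dt_scale: "Dt j (\<lambda>u. c * \<xi> u) v = c * Dt j \<xi> v"
  by (simp add: Dt_def algebra_simps)

lemma Dt_sum: "Dt j (\<lambda>u. \<Sum>i\<in>S. \<xi> i u) v = (\<Sum>i\<in>S. Dt j (\<xi> i) v)"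
  by (induction S rule: infinite_finite_induct) (simp_all add: Dt_add, simp_all add: Dt_def)

text \<open>The delicate terms come from x^(a_0), which shifts all coordinates at once. In either
  order they contribute l_i l_j / l_0 at v - a_0, which is symmetric in i and j. Support in V is
  assumed because \<open>coords\<close> is meaningful only there.\<close>

lemma Dt_commute:
  assumes \<xi>: "\<And>u. \<xi> u \<noteq> 0 \<Longrightarrow> u \<in> V" and ij: "i \<in> {1..m}" "j \<in> {1..m}"
  shows "Dt i (Dt j \<xi>) v = Dt j (Dt i \<xi>) v"
proof (cases "v \<in> V")
  case True
  define r where "r k = cst (complex_of_real (real (l k) / real (l 0)))" for k
  define c where "c k = cst (complex_of_real (cs v k))" for k
  have r: "of_nat (l j) * r i = of_nat (l i) * r j"
  proof -
    have "complex_of_nat (l j) * complex_of_real (real (l i) / real (l 0))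
        = complex_of_nat (l i) * complex_of_real (real (l j) / real (l 0))"
      by simp
    from arg_cong[OF this, of cst] show ?thesis
      unfolding cst_mult cst_of_nat r_def .
  qed
  have e0: "Dt k \<xi> (v - a 0)
      = (c k - r k) * \<xi> (v - a 0) + of_nat (l k) * \<xi> (v - a 0 - a k)
        - of_nat (l k) * lam * \<xi> (v - a 0 - a 0)" if "k \<in> {1..m}" for k
  proof -
    have "cs (v - a 0) k = cs v k - real (l k) / real (l 0)"
      using that True by (simp add: coords_diff a_V coords_a0)
    then show ?thesis unfolding Dt_def c_def r_def by (simp only: of_real_diff cst_diff)
  qed
  have e1: "Dt k \<xi> (v - a h)
      = c k * \<xi> (v - a h) + of_nat (l k) * \<xi> (v - a h - a k)
        - of_nat (l k) * lam * \<xi> (v - a 0 - a h)" if "h \<in> {1..m}" "h \<noteq> k" for h k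
    using that True by (simp add: Dt_def c_def coords_diff_a cancel_ab_semigroup_add_class.diff_right_commute[of v "a h" "a 0"])
  show ?thesis
  \<comment> \<open>For i = j the shift by a_j would change the coordinate in question, and
    \<open>e1\<close> does not apply; but then the two sides coincide.\<close>
  proof (cases "i = j")
    case True
    then show ?thesis by (simp only:)
  next
    case False
    show ?thesis
      unfolding Dt_def[of i "Dt j \<xi>"] Dt_def[of j "Dt i \<xi>"]
        e0[OF ij(1)] e0[OF ij(2)] e1[OF ij(1) False] e1[OF ij(2) False[symmetric]]
        Dt_def[of _ \<xi> v] c_def[symmetric]
        cancel_ab_semigroup_add_class.diff_right_commute[of v "a j" "a i"]
      by (rule twisted_commutator[OF r])
  qed
next
  case False
  have z: "\<xi> u = 0" if "u \<notin> V" for u using \<xi> that by blast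
  have "i \<le> m" "j \<le> m" using ij by auto
  then show ?thesis using False
    by (simp add: Dt_def z V_diff_a)
qed

text \<open>Removing j and then i from I carries the opposite sign of removing i and then j, whereas
  the operators commute; so the double sum is antisymmetric.\<close>

lemma grad_grad:
  assumes \<omega>: "\<omega> \<in> filt k D"
  shows "grad (grad \<omega>) I v = 0"
proof (cases "I \<subseteq> {1..m}")
  case True
  then have finI: "finite I" by (rule finite_subset) simp
  define F where "F j i = sg I j * (sg (I - {j}) i * Dt j (Dt i (\<omega> (I - {j} - {i}))) v)" for j i
  have gI: "grad \<omega> (I - {j}) = (\<lambda>u. \<Sum>i\<in>I - {j}. sg (I - {j}) i * Dt i (\<omega> (I - {j} - {i})) u)" for j
  proof
    have "I - {j} \<subseteq> {1..m}" using True by blast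
    then show "grad \<omega> (I - {j}) u = (\<Sum>i\<in>I - {j}. sg (I - {j}) i * Dt i (\<omega> (I - {j} - {i})) u)" for u
      by (simp only: grad_apply if_True)
  qed
  have "grad (grad \<omega>) I v = (\<Sum>j\<in>I. \<Sum>i\<in>I - {j}. F j i)"
    unfolding grad_apply[of "grad \<omega>"] gI Dt_sum Dt_scale sum_distrib_left F_def
    using True by (simp only: if_True)
  also have "\<dots> = 0"
  proof (rule antisym_double_sum[OF finI ratfun_two_neq_0])
    have anti: "F j i = - F i j" if "i \<in> I" "j \<in> I" "i < j" for i j
    proof -
      have s: "sg (I - {j}) i = sg I i" "sg (I - {i}) j = - sg I j"
        using that finI by (simp_all add: sg_remove_ge sg_remove_less)
      have "I - {i} - {j} = I - {j} - {i}" by blast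
      moreover have "i \<in> {1..m}" "j \<in> {1..m}" using that True by blast+
      ultimately have D: "Dt j (Dt i (\<omega> (I - {j} - {i}))) v = Dt i (Dt j (\<omega> (I - {i} - {j}))) v"
        using Dt_commute[of "\<omega> (I - {j} - {i})" j i v] filtD(4)[OF \<omega>] by metis
      show ?thesis unfolding F_def s D by (simp only: mult_minus_left mult_minus_right minus_minus mult.left_commute)
    qed
    show "F j i = - F i j" if "i \<in> I" "j \<in> I" "i \<noteq> j" for i j
    proof (cases "i < j")
      case True
      then show ?thesis using anti that by blast
    next
      case False
      then have "j < i" using that by simp
      then have "F i j = - F j i" using anti that by blast
      then show ?thesis by (simp only: minus_minus)
    qed
  qed
  finally show ?thesis .
qed (simp only: grad_apply if_False)

lemma grad_add: "grad (\<omega> + \<eta>) = grad \<omega> + grad \<eta>"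
  by (auto simp: fun_eq_iff grad_apply plus_fun_def Dt_add distrib_left sum.distrib)

lemma grad_scale: "grad (\<lambda>J u. c * \<omega> J u) = (\<lambda>J u. c * grad \<omega> J u)"
  by (auto simp: fun_eq_iff grad_apply Dt_scale sum_distrib_left mult.left_commute)

lemma lev_remove:
  assumes "finite I" "j \<in> I" shows "lev (I - {j}) v = lev I v + 1"
proof -
  have "card I > 0" using assms card_gt_0_iff by blast
  then show ?thesis using assms by (simp add: lev_def of_nat_diff)
qed

text \<open>The new index j needs a positive coordinate, and each part of the operator supplies one:
  the diagonal part has the coordinate itself as a factor, x^(a_j) adds 1 to it, and all coordinates
  of a_0 are positive. For the same reason the complex is closed under the differential.\<close>

lemma grad_filt:
  assumes \<omega>: "\<omega> \<in> filt k D"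
  shows "grad \<omega> \<in> filt (Suc k) D"
  unfolding filt_def
proof safe
  fix I v assume nz: "grad \<omega> I v \<noteq> 0"
  then have I: "I \<subseteq> {1..m}" by (auto simp: grad_apply split: if_splits)
  then have finI: "finite I" using finite_subset by blast
  from nz I obtain j where j: "j \<in> I" "Dt j (\<omega> (I - {j})) v \<noteq> 0"
    unfolding grad_apply using sum.neutral[of I "\<lambda>j. sg I j * Dt j (\<omega> (I - {j})) v"] by force
  have jm: "j \<in> {1..m}" using j I by auto
  have card: "card (I - {j}) = k \<Longrightarrow> card I = Suc k"
    using j finI by (metis card.remove)
  have lev: "lev (I - {j}) v = lev I v + 1"
    using lev_remove[OF finI j(1)] by simp
  consider "cs v j \<noteq> 0" "\<omega> (I - {j}) v \<noteq> 0" | "\<omega> (I - {j}) (v - a j) \<noteq> 0"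
    | "\<omega> (I - {j}) (v - a 0) \<noteq> 0"
    using j(2) by (fastforce simp: Dt_def)
  then show "(I, v) \<in> cells (Suc k) D"
  proof cases
    case 1
    note f = filtD[OF \<omega> 1(2)]
    have "0 < cs v j" using 1(1) M_nonneg[OF f(3), of j] by simp
    then have "0 < cs v i" if "i \<in> I" for i using f(5)[of i] that by (cases "i = j") auto
    then show ?thesis using f I card lev by (simp add: cells_def)
  next
    case 2
    note f = filtD[OF \<omega> 2]
    have vV: "v \<in> V" by (rule V_diff_a[of j, THEN iffD1, OF _ f(4)]) (use jm in simp)
    have nn: "0 \<le> cs v i" "i \<noteq> j \<Longrightarrow> cs (v - a j) i = cs v i" for i
      using M_nonneg[OF f(3), of i] vV jm by (auto simp: coords_diff_a split: if_splits)
    have "cs v j > 0" using M_nonneg[OF f(3), of j] vV jm by (simp add: coords_diff_a)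
    then have "0 < cs v i" if "i \<in> I" for i using f(5)[of i] nn(2)[of i] that by (cases "i = j") auto
    moreover have "lev (I - {j}) (v - a j) = lev I v"
      using lev vV jm by (simp add: lev_def deg_diff_a)
    ultimately show ?thesis using f I card nn vV by (simp add: cells_def M_iff)
  next
    case 3
    note f = filtD[OF \<omega> 3]
    have vV: "v \<in> V" by (rule V_diff_a[of 0, THEN iffD1, OF _ f(4)]) simp
    have c: "cs v i = cs (v - a 0) i + cs (a 0) i" for i
      using vV by (simp add: coords_diff a_V)
    have nn: "0 \<le> cs v i" for i
      using M_nonneg[OF f(3), of i] c coords_a0_nonneg[of i] by simp
    have "0 < cs v i" if "i \<in> I" for i
      using M_nonneg[OF f(3), of i] c coords_a0_pos[of i] that I by (auto simp: add_nonneg_pos)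
    moreover have "lev (I - {j}) (v - a 0) = lev I v"
      using lev vV by (simp add: lev_def deg_diff_a0)
    ultimately show ?thesis using f I card nn vV by (simp add: cells_def M_iff)
  qed
qed

section \<open>The contracting homotopy at lambda = 0\<close>

definition mex :: "nat set \<Rightarrow> nat" where
  "mex I = (LEAST f. 1 \<le> f \<and> f \<notin> I)"

lemma mex_props:
  assumes "finite I" shows "1 \<le> mex I" "mex I \<notin> I"
proof -
  obtain f where "f \<notin> insert 0 I"
    using ex_new_if_finite[of "insert 0 I"] assms by auto
  then have "1 \<le> f \<and> f \<notin> I" by (cases f) auto
  from LeastI[of "\<lambda>f. 1 \<le> f \<and> f \<notin> I", OF this] show "1 \<le> mex I" "mex I \<notin> I"
    unfolding mex_def by blast+
qed

lemma less_mex: "1 \<le> i \<Longrightarrow> i < mex I \<Longrightarrow> i \<in> I"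
  unfolding mex_def using not_less_Least by blast

lemma mexI:
  assumes "1 \<le> f" "f \<notin> I" "\<And>i. 1 \<le> i \<Longrightarrow> i < f \<Longrightarrow> i \<in> I"
  shows "mex I = f"
  unfolding mex_def by (rule Least_equality) (use assms not_less in blast)+

text \<open>Describes the targets x^v e_I of the homotopy. With f = \<open>mex I\<close>, the source
  is x^(v + a_f) with f inserted into I. The indices below f lie in I by minimality, so bounding
  their coordinates by 1 makes f the first index at which the source fails to have a coordinate
  below 1. Since I is not everything, f is at most m.\<close>

definition active :: "nat set \<Rightarrow> ('n \<Rightarrow> int) \<Rightarrow> bool" where
  "active I v \<longleftrightarrow> I \<subseteq> {1..m} \<and> I \<noteq> {1..m} \<and> v \<in> M \<and> (\<forall>i. 1 \<le> i \<longrightarrow> i < mex I \<longrightarrow> cs v i < 1)"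

definition hop :: "(nat set \<Rightarrow> ('n \<Rightarrow> int) \<Rightarrow> ratfun) \<Rightarrow> nat set \<Rightarrow> ('n \<Rightarrow> int) \<Rightarrow> ratfun" where
  "hop \<omega> I v = (if active I v
     then sg I (mex I) * (inverse (of_nat (l (mex I))) * \<omega> (insert (mex I) I) (v + a (mex I)))
     else 0)"

text \<open>On cochains the exponents that survive also have positive coordinates, because the
  coefficient of e_1...e_m has its support there.\<close>

definition proj :: "(nat set \<Rightarrow> ('n \<Rightarrow> int) \<Rightarrow> ratfun) \<Rightarrow> nat set \<Rightarrow> ('n \<Rightarrow> int) \<Rightarrow> ratfun" where
  "proj \<omega> I v = (if I = {1..m} \<and> (\<forall>i\<in>{1..m}. cs v i < 1) then \<omega> I v else 0)"

definition grad0 :: "(nat set \<Rightarrow> ('n \<Rightarrow> int) \<Rightarrow> ratfun) \<Rightarrow> nat set \<Rightarrow> ('n \<Rightarrow> int) \<Rightarrow> ratfun" where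
  "grad0 \<omega> I v = (if I \<subseteq> {1..m}
     then \<Sum>j\<in>I. sg I j * (of_nat (l j) * \<omega> (I - {j}) (v - a j)) else 0)"

definition gradE :: "(nat set \<Rightarrow> ('n \<Rightarrow> int) \<Rightarrow> ratfun) \<Rightarrow> nat set \<Rightarrow> ('n \<Rightarrow> int) \<Rightarrow> ratfun" where
  "gradE \<omega> I v = (if I \<subseteq> {1..m}
     then \<Sum>j\<in>I. sg I j * (cst (complex_of_real (cs v j)) * \<omega> (I - {j}) v) else 0)"

definition gradN :: "(nat set \<Rightarrow> ('n \<Rightarrow> int) \<Rightarrow> ratfun) \<Rightarrow> nat set \<Rightarrow> ('n \<Rightarrow> int) \<Rightarrow> ratfun" where
  "gradN \<omega> I v = (if I \<subseteq> {1..m}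
     then \<Sum>j\<in>I. sg I j * (of_nat (l j) * \<omega> (I - {j}) (v - a 0)) else 0)"

lemma grad_split: "grad \<omega> I v = grad0 \<omega> I v + gradE \<omega> I v - lam * gradN \<omega> I v"
proof (cases "I \<subseteq> {1..m}")
  case True
  have "sg I j * Dt j (\<omega> (I - {j})) v
      = sg I j * (of_nat (l j) * \<omega> (I - {j}) (v - a j))
        + sg I j * (cst (complex_of_real (cs v j)) * \<omega> (I - {j}) v)
        - lam * (sg I j * (of_nat (l j) * \<omega> (I - {j}) (v - a 0)))" for j
    unfolding Dt_def by (simp only: algebra_simps)
  then show ?thesis
    using True by (simp only: grad_apply grad0_def gradE_def gradN_def if_True
        sum.distrib sum_subtractf sum_distrib_left)
qed (simp add: grad_apply grad0_def gradE_def gradN_def)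

lemma hop_eq_0: "(active I v \<Longrightarrow> \<omega> (insert (mex I) I) (v + a (mex I)) = 0) \<Longrightarrow> hop \<omega> I v = 0"
  unfolding hop_def by (cases "active I v") (simp_all only: if_True if_False mult_zero_right)

lemma hop_split:
  assumes "\<And>I v. \<omega> I v = \<xi> I v + \<eta> I v - c * \<zeta> I v"
  shows "hop \<omega> I v = hop \<xi> I v + hop \<eta> I v - c * hop \<zeta> I v"
  unfolding hop_def assms by (cases "active I v") (simp_all add: algebra_simps)

lemma M_diff_a: "j \<in> {1..m} \<Longrightarrow> v - a j \<in> M \<longleftrightarrow> v \<in> M \<and> 1 \<le> cs v j"
proof -
  assume j: "j \<in> {1..m}"
  show ?thesis
  proof (cases "v \<in> V")
    case True
    have "(\<forall>i. 0 \<le> cs (v - a j) i) \<longleftrightarrow> (\<forall>i. 0 \<le> cs v i) \<and> 1 \<le> cs v j"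
    proof (intro iffI conjI allI)
      assume h: "\<forall>i. 0 \<le> cs (v - a j) i"
      show "0 \<le> cs v i" for i using h[rule_format, of i] coords_diff_a[OF True j, of i] by (cases "i = j") simp_all
      show "1 \<le> cs v j" using h[rule_format, of j] coords_diff_a[OF True j, of j] by simp
    next
      assume "(\<forall>i. 0 \<le> cs v i) \<and> 1 \<le> cs v j"
      then show "0 \<le> cs (v - a j) i" for i using coords_diff_a[OF True j, of i] by (cases "i = j") simp_all
    qed
    then show ?thesis using True V_diff_a[of j v] j by (simp add: M_iff)
  next
    case False
    then show ?thesis using V_diff_a[of j v] j by (simp add: M_iff)
  qed
qed

lemma mex_le_m:
  assumes "I \<subseteq> {1..m}" "I \<noteq> {1..m}" shows "mex I \<in> {1..m}"
proof -
  have "finite I" using assms finite_subset by blast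
  then have "1 \<le> mex I" by (rule mex_props)
  moreover have "mex I \<le> m"
  proof (rule ccontr)
    assume "\<not> mex I \<le> m"
    then have "{1..m} \<subseteq> I" using less_mex[of _ I] by auto
    then show False using assms by blast
  qed
  ultimately show ?thesis by simp
qed

lemma sg_scale_cancel:
  assumes "j \<in> {1..m}"
  shows "sg I j * (of_nat (l j) * (sg I j * (inverse (of_nat (l j)) * x))) = x"
proof -
  have "l j \<noteq> 0" using l_pos assms by auto
  then have nz: "(of_nat (l j) :: ratfun) \<noteq> 0"
    by (simp add: cst_conv flip: cst_of_nat)
  have "sg I j * (of_nat (l j) * (sg I j * (inverse (of_nat (l j)) * x)))
      = (sg I j * sg I j) * ((of_nat (l j) * inverse (of_nat (l j))) * x)"
    by (simp only: mult_ac)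
  then show ?thesis using nz by (simp add: sg_sq)
qed

text \<open>The coefficient at (I, v) is compared in three cases. If some g below
  \<open>mex I\<close> has coordinate at least 1, x^v e_I is a source of h, and for the least such g
  only the summand j = g of nabla_0 h survives. If there is no such g and I is everything, only the
  projection contributes. Otherwise x^v e_I is a target: in h nabla_0 the summand of the inserted
  index returns the coefficient, and the other summands cancel against nabla_0 h.\<close>

lemma homotopy:
  assumes \<omega>: "\<omega> \<in> filt k D"
  shows "grad0 (hop \<omega>) I v + hop (grad0 \<omega>) I v + proj \<omega> I v = \<omega> I v"
proof (cases "I \<subseteq> {1..m} \<and> v \<in> M")
  case False
  have z: "\<omega> I v = 0" using False filtD[OF \<omega>, of I v] by blast
  moreover have "proj \<omega> I v = 0" unfolding proj_def z by (simp only: if_cancel)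
  moreover have "hop (grad0 \<omega>) I v = 0"
    by (rule hop_eq_0) (use False in \<open>simp add: active_def\<close>)
  moreover have "grad0 (hop \<omega>) I v = 0"
  proof (cases "I \<subseteq> {1..m}")
    case True
    have "hop \<omega> (I - {j}) (v - a j) = 0" if "j \<in> I" for j
    proof (rule hop_eq_0)
      assume "active (I - {j}) (v - a j)"
      then have "v - a j \<in> M" by (simp add: active_def)
      moreover have "j \<in> {1..m}" using that True by blast
      ultimately have "v \<in> M" using M_diff_a by blast
      then show "\<omega> (insert (mex (I - {j})) (I - {j})) (v - a j + a (mex (I - {j}))) = 0"
        using True False by blast
    qed
    then show ?thesis by (simp add: grad0_def)
  qed (simp add: grad0_def)
  ultimately show ?thesis by simp
next
  case True
  then have I: "I \<subseteq> {1..m}" and v: "v \<in> M" by blast+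
  have vV: "v \<in> V" using v by (rule M_V)
  have finI: "finite I" using I finite_subset by blast
  have jm: "j \<in> {1..m}" if "j \<in> I" for j using that I by blast
  have g0: "grad0 (hop \<omega>) I v = (\<Sum>j\<in>I. sg I j * (of_nat (l j) * hop \<omega> (I - {j}) (v - a j)))"
    using I by (simp only: grad0_def if_True)
  show ?thesis
  proof (cases "\<exists>g. 1 \<le> g \<and> g < mex I \<and> 1 \<le> cs v g")
    case True
    define g where "g = (LEAST g. 1 \<le> g \<and> g < mex I \<and> 1 \<le> cs v g)"
    have g: "1 \<le> g" "g < mex I" "1 \<le> cs v g"
      using LeastI_ex[OF True] unfolding g_def by blast+
    have gmin: "cs v i < 1" if "1 \<le> i" "i < g" for i
      using not_less_Least[of i "\<lambda>g. 1 \<le> g \<and> g < mex I \<and> 1 \<le> cs v g"] that g(2)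
      unfolding g_def by force
    have gI: "g \<in> I" using g less_mex by blast
    have "\<not> active I v" using g unfolding active_def by (meson not_less)
    then have h0: "hop (grad0 \<omega>) I v = 0" by (simp add: hop_def)
    have "\<not> (\<forall>i\<in>{1..m}. cs v i < 1)" using g(3) jm[OF gI] by (meson not_less)
    then have p0: "proj \<omega> I v = 0" unfolding proj_def by metis
    \<comment> \<open>For j < g the coordinate of v at j is below 1, so v - a_j leaves M. For j > g,
      removing j keeps g below the \<open>mex\<close>, and the coordinate at g is too large for (I -
      {j}, v - a_j) to be a target.\<close>
    have other: "hop \<omega> (I - {j}) (v - a j) = 0" if j: "j \<in> I" "j \<noteq> g" for j
    proof (rule hop_eq_0)
      assume act: "active (I - {j}) (v - a j)"
      then have "v - a j \<in> M" by (simp add: active_def)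
      then have "1 \<le> cs v j" using M_diff_a jm j by blast
      then have "\<not> j < g" using gmin[of j] jm[OF j(1)] by fastforce
      then have jg: "g < j" using j by simp
      have "g < mex (I - {j})"
      proof (rule ccontr)
        let ?f = "mex (I - {j})"
        assume "\<not> g < ?f"
        moreover have "1 \<le> ?f" "?f \<notin> I - {j}" using mex_props[of "I - {j}"] finI by blast+
        ultimately show False using less_mex[of ?f I] g jg by auto
      qed
      then have "cs (v - a j) g < 1" using act g unfolding active_def by blast
      then have "cs v g < 1" using coords_diff_a[OF vV jm[OF j(1)], of g] j by simp
      then show "\<omega> (insert (mex (I - {j})) (I - {j})) (v - a j + a (mex (I - {j}))) = 0"
        using g by simp
    qed
    have mg: "mex (I - {g}) = g"
    proof (rule mexI[OF g(1)])
      fix i assume "1 \<le> i" "i < g"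
      then show "i \<in> I - {g}" using less_mex[of i I] g by simp
    qed simp
    have "active (I - {g}) (v - a g)"
      unfolding active_def mg
    proof (intro conjI allI impI)
      show "I - {g} \<subseteq> {1..m}" using I by blast
      show "I - {g} \<noteq> {1..m}" using jm[OF gI] by blast
      show "v - a g \<in> M" using M_diff_a[OF jm[OF gI]] v g by blast
      show "cs (v - a g) i < 1" if "1 \<le> i" "i < g" for i
        using coords_diff_a[OF vV jm[OF gI], of i] gmin[OF that] that by simp
    qed
    then have hg: "hop \<omega> (I - {g}) (v - a g) = sg I g * (inverse (of_nat (l g)) * \<omega> I v)"
      using gI by (simp add: hop_def mg sg_remove_ge insert_absorb)
    have "grad0 (hop \<omega>) I v = (\<Sum>j\<in>I. if j = g then \<omega> I v else 0)"
      unfolding g0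
    proof (intro sum.cong refl)
      fix j assume j: "j \<in> I"
      show "sg I j * (of_nat (l j) * hop \<omega> (I - {j}) (v - a j)) = (if j = g then \<omega> I v else 0)"
        using other[OF j] hg sg_scale_cancel[OF jm[OF gI]] by (cases "j = g") simp_all
    qed
    also have "\<dots> = \<omega> I v" using gI finI by simp
    finally show ?thesis using h0 p0 by simp
  next
    case False
    then have small: "cs v i < 1" if "1 \<le> i" "i < mex I" for i using that by force
    show ?thesis
    proof (cases "I = {1..m}")
      case full: True
      have "m < mex I"
        using mex_props[OF finI] full by (metis atLeastAtMost_iff not_less)
      then have lt1: "cs v i < 1" if "i \<in> {1..m}" for i using small[of i] that by simp
      have "hop \<omega> (I - {j}) (v - a j) = 0" if j: "j \<in> I" for j
      proof (rule hop_eq_0)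
        assume "active (I - {j}) (v - a j)"
        then have "v - a j \<in> M" by (simp add: active_def)
        then have "1 \<le> cs v j" using M_diff_a jm j by blast
        then show "\<omega> (insert (mex (I - {j})) (I - {j})) (v - a j + a (mex (I - {j}))) = 0"
          using lt1[OF jm[OF j]] by simp
      qed
      then have "grad0 (hop \<omega>) I v = 0" by (simp add: grad0_def)
      moreover have "hop (grad0 \<omega>) I v = 0"
        by (rule hop_eq_0) (use full in \<open>simp add: active_def\<close>)
      moreover have "proj \<omega> I v = \<omega> I v" using full lt1 by (simp add: proj_def)
      ultimately show ?thesis by simp
    next
      case proper: False
      define f where "f = mex I"
      let ?I = "insert f I"
      have f: "f \<in> {1..m}" "f \<notin> I" using mex_le_m[OF I proper] mex_props[OF finI] by (simp_all add: f_def)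
      have act: "active I v" using I proper v small by (simp add: active_def)
      have p0: "proj \<omega> I v = 0" using proper by (simp add: proj_def)
      have sub: "?I \<subseteq> {1..m}" using I f by blast
      have "grad0 \<omega> ?I (v + a f)
          = sg ?I f * (of_nat (l f) * \<omega> (?I - {f}) (v + a f - a f))
            + (\<Sum>j\<in>I. sg ?I j * (of_nat (l j) * \<omega> (?I - {j}) (v + a f - a j)))"
        using sub f finI by (simp only: grad0_def if_True sum.insert not_False_eq_True)
      also have "sg ?I f * (of_nat (l f) * \<omega> (?I - {f}) (v + a f - a f)) = sg I f * (of_nat (l f) * \<omega> I v)"
        using f by (simp add: sg_insert_ge)
      finally have "hop (grad0 \<omega>) I v
          = sg I f * (inverse (of_nat (l f)) * (sg I f * (of_nat (l f) * \<omega> I v)))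
            + sg I f * (inverse (of_nat (l f)) *
               (\<Sum>j\<in>I. sg ?I j * (of_nat (l j) * \<omega> (?I - {j}) (v + a f - a j))))"
        using act by (simp only: hop_def if_True distrib_left flip: f_def)
      also have "sg I f * (inverse (of_nat (l f)) * (sg I f * (of_nat (l f) * \<omega> I v))) = \<omega> I v"
        using sg_scale_cancel[OF f(1), of I "\<omega> I v"] by (simp only: mult_ac)
      also have "sg I f * (inverse (of_nat (l f)) *
               (\<Sum>j\<in>I. sg ?I j * (of_nat (l j) * \<omega> (?I - {j}) (v + a f - a j)))) = - grad0 (hop \<omega>) I v"
        unfolding g0 sum_distrib_left sum_negf[symmetric]
      proof (intro sum.cong refl)
        fix j assume j: "j \<in> I"
        have jf: "j \<noteq> f" using j f by blast
        show "sg I f * (inverse (of_nat (l f)) * (sg ?I j * (of_nat (l j) * \<omega> (?I - {j}) (v + a f - a j))))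
            = - (sg I j * (of_nat (l j) * hop \<omega> (I - {j}) (v - a j)))"
        \<comment> \<open>If the coordinate at j is below 1, subtracting a_j leaves M and both sides
          vanish. Otherwise f < j, because all coordinates before f are below 1. Removing j then
          does not change the \<open>mex\<close>, and inserting f below j produces the minus
          sign.\<close>
        proof (cases "1 \<le> cs v j")
          case False
          have "\<omega> (?I - {j}) (v + a f - a j) = 0"
          proof (rule ccontr)
            assume "\<omega> (?I - {j}) (v + a f - a j) \<noteq> 0"
            from filtD(3)[OF \<omega> this] have "1 \<le> cs (v + a f) j" using M_diff_a jm j by blast
            then show False using False coords_add_a[OF vV f(1), of j] jf by simp
          qed
          moreover have "hop \<omega> (I - {j}) (v - a j) = 0"
            by (rule hop_eq_0) (use False M_diff_a[OF jm[OF j]] in \<open>simp add: active_def\<close>)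
          ultimately show ?thesis by simp
        next
          case True
          then have "\<not> j < f" using small[of j] jm[OF j] by (force simp: f_def)
          then have fj: "f < j" using jf by simp
          have mj: "mex (I - {j}) = f"
          proof (rule mexI)
            show "1 \<le> f" using f by simp
            show "f \<notin> I - {j}" using f by simp
            fix i assume "1 \<le> i" "i < f"
            then show "i \<in> I - {j}" using less_mex[of i I] fj by (simp add: f_def)
          qed
          have "active (I - {j}) (v - a j)"
            unfolding active_def mj
          proof (intro conjI allI impI)
            show "I - {j} \<subseteq> {1..m}" using I by blast
            show "I - {j} \<noteq> {1..m}" using jm[OF j] by blast
            show "v - a j \<in> M" using M_diff_a[OF jm[OF j]] v True by blast
            show "cs (v - a j) i < 1" if "1 \<le> i" "i < f" for i
              using coords_diff_a[OF vV jm[OF j], of i] small[of i] that fj by (simp add: f_def)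
          qed
          then have h: "hop \<omega> (I - {j}) (v - a j)
              = sg (I - {j}) f * (inverse (of_nat (l f)) * \<omega> (insert f (I - {j})) (v - a j + a f))"
            by (simp only: hop_def mj if_True)
          have s: "sg ?I j = - sg I j" "sg (I - {j}) f = sg I f"
            using fj f finI by (simp_all add: sg_insert_less sg_remove_ge)
          have e: "insert f (I - {j}) = ?I - {j}" "v - a j + a f = v + a f - a j"
            using jf by (auto simp: diff_add_eq)
          show ?thesis unfolding h s e
            by (simp only: mult_minus_left mult_minus_right mult_ac)
        qed
      qed
      finally show ?thesis using p0 by simp
    qed
  qed
qed

lemma lev_active:
  assumes "active I v" shows "lev (insert (mex I) I) (v + a (mex I)) = lev I v"
proof -
  have I: "I \<subseteq> {1..m}" "I \<noteq> {1..m}" "v \<in> V" using assms M_V by (simp_all add: active_def)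
  then have "finite I" using finite_subset by blast
  then show ?thesis
    using mex_props[of I] deg_add_a[OF I(3) mex_le_m[OF I(1,2)]] by (simp add: lev_def)
qed

lemma lev_remove_a0:
  assumes "finite I" "j \<in> I" "v \<in> V" shows "lev (I - {j}) (v - a 0) = lev I v"
  using lev_remove[OF assms(1,2), of v] deg_diff_a0[OF assms(3)] by (simp add: lev_def)

lemma hop_filt:
  assumes \<omega>: "\<omega> \<in> filt (Suc k) D"
  shows "hop \<omega> \<in> filt k D"
proof (rule filtI)
  fix I v assume nz: "hop \<omega> I v \<noteq> 0"
  then have act: "active I v" and nz': "\<omega> (insert (mex I) I) (v + a (mex I)) \<noteq> 0"
    using hop_eq_0 by (metis hop_def)+
  note f = filtD[OF \<omega> nz']
  have I: "I \<subseteq> {1..m}" "I \<noteq> {1..m}" "v \<in> M" using act by (simp_all add: active_def)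
  have finI: "finite I" using I finite_subset by blast
  have "card I = k" using f(2) mex_props[OF finI] finI by simp
  moreover have "0 < cs v j" if "j \<in> I" for j
  proof -
    have "j \<noteq> mex I" using mex_props[OF finI] that by blast
    then have "cs (v + a (mex I)) j = cs v j"
      using coords_add_a[OF M_V[OF I(3)] mex_le_m[OF I(1,2)], of j] by simp
    then show ?thesis using f(5)[of j] that by (metis insertI2)
  qed
  moreover have "lev I v \<le> D" using f(6) unfolding lev_active[OF act] .
  ultimately show "I \<subseteq> {1..m} \<and> card I = k \<and> v \<in> M \<and> (\<forall>j\<in>I. 0 < cs v j) \<and> lev I v \<le> D"
    using I by blast
qed

lemma hop_filt_0:
  assumes \<omega>: "\<omega> \<in> filt 0 D"
  shows "hop \<omega> = 0"
proof (intro ext)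
  fix I v
  have "\<omega> (insert (mex I) I) (v + a (mex I)) = 0" if "active I v"
  proof (rule ccontr)
    assume nz: "\<omega> (insert (mex I) I) (v + a (mex I)) \<noteq> 0"
    have "finite (insert (mex I) I)" using that finite_subset unfolding active_def by blast
    then show False using filtD(2)[OF \<omega> nz] by simp
  qed
  then show "hop \<omega> I v = 0 I v" using hop_eq_0[of I v \<omega>] by simp
qed

lemma proj_filt:
  assumes \<omega>: "\<omega> \<in> filt k D" shows "proj \<omega> \<in> filt k D"
proof (rule filtI)
  fix I v assume "proj \<omega> I v \<noteq> 0"
  then have "\<omega> I v \<noteq> 0" unfolding proj_def by metis
  from filtD[OF \<omega> this]
  show "I \<subseteq> {1..m} \<and> card I = k \<and> v \<in> M \<and> (\<forall>j\<in>I. 0 < cs v j) \<and> lev I v \<le> D" by blast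
qed

lemma proj_filt_less:
  assumes \<omega>: "\<omega> \<in> filt k D" and "k < m" shows "proj \<omega> = 0"
proof (intro ext)
  fix I v
  show "proj \<omega> I v = 0 I v"
  proof (cases "I = {1..m}")
    case True
    have z: "\<omega> I v = 0" using filtD(2)[OF \<omega>, of I v] True assms(2) by force
    show ?thesis unfolding proj_def z zero_fun_apply by (simp only: if_cancel)
  qed (simp add: proj_def)
qed

lemma hop_add: "hop (\<omega> + \<eta>) = hop \<omega> + hop \<eta>"
  by (auto simp: fun_eq_iff hop_def distrib_left)

lemma hop_scale: "hop (\<lambda>J u. c * \<omega> J u) = (\<lambda>J u. c * hop \<omega> J u)"
  by (auto simp: fun_eq_iff hop_def mult.left_commute)

lemma proj_add: "proj (\<omega> + \<eta>) = proj \<omega> + proj \<eta>"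
  by (auto simp: fun_eq_iff proj_def)

lemma proj_scale: "proj (\<lambda>J u. c * \<omega> J u) = (\<lambda>J u. c * proj \<omega> J u)"
  by (auto simp: fun_eq_iff proj_def)

section \<open>The operator U: injectivity and surjectivity\<close>

definition U :: "(nat set \<Rightarrow> ('n \<Rightarrow> int) \<Rightarrow> ratfun) \<Rightarrow> nat set \<Rightarrow> ('n \<Rightarrow> int) \<Rightarrow> ratfun" where
  "U \<omega> = grad (hop \<omega>) + hop (grad \<omega>) + proj \<omega>"

lemma U_add: "U (\<omega> + \<eta>) = U \<omega> + U \<eta>"
  by (simp only: U_def grad_add hop_add proj_add add_ac)

lemma U_scale: "U (\<lambda>J u. c * \<omega> J u) = (\<lambda>J u. c * U \<omega> J u)"
  by (simp only: U_def grad_scale hop_scale proj_scale plus_fun_def distrib_left)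

lemma U_eq:
  assumes \<omega>: "\<omega> \<in> filt k D"
  shows "U \<omega> I v = \<omega> I v + (gradE (hop \<omega>) I v + hop (gradE \<omega>) I v)
    - lam * (gradN (hop \<omega>) I v + hop (gradN \<omega>) I v)"
proof -
  have h: "hop (grad \<omega>) I v = hop (grad0 \<omega>) I v + hop (gradE \<omega>) I v - lam * hop (gradN \<omega>) I v"
    by (rule hop_split) (rule grad_split)
  have "U \<omega> I v = grad (hop \<omega>) I v + hop (grad \<omega>) I v + proj \<omega> I v"
    by (simp only: U_def plus_fun_apply)
  also have "\<dots> = (grad0 (hop \<omega>) I v + hop (grad0 \<omega>) I v + proj \<omega> I v)
      + (gradE (hop \<omega>) I v + hop (gradE \<omega>) I v)
      - lam * (gradN (hop \<omega>) I v + hop (gradN \<omega>) I v)"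
    unfolding grad_split[of "hop \<omega>"] h by (simp only: algebra_simps)
  finally show ?thesis unfolding homotopy[OF \<omega>] .
qed

lemma U_filt:
  assumes \<omega>: "\<omega> \<in> filt k D" shows "U \<omega> \<in> filt k D"
proof -
  have "grad (hop \<omega>) \<in> filt k D"
  proof (cases k)
    case 0
    then have "hop \<omega> = 0" using hop_filt_0 \<omega> by blast
    then have "grad (hop \<omega>) = 0" using grad_scale[of 0 "hop \<omega>"] by (simp add: zero_fun_def)
    then show ?thesis using filt_0 by simp
  next
    case (Suc k')
    then show ?thesis using grad_filt[OF hop_filt] \<omega> by blast
  qed
  moreover have "hop (grad \<omega>) \<in> filt k D" using hop_filt[OF grad_filt[OF \<omega>]] .
  ultimately show ?thesis unfolding U_def using proj_filt[OF \<omega>] filt_add by blast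
qed

lemma lam_dvd_hop:
  assumes "active I v \<Longrightarrow> lam_dvd r (\<omega> (insert (mex I) I) (v + a (mex I)))"
  shows "lam_dvd r (hop \<omega> I v)"
  unfolding hop_def sg_def using assms
  by (cases "active I v")
    (simp_all only: if_True if_False lam_dvd_0 lam_dvd_sign_mult lam_dvd_inverse_of_nat_mult)

text \<open>On the top level the terms coming from gradE vanish, so that a kernel element of U is
  divisible there by one more power of lambda than it is assumed to be.\<close>

lemma U_kernel_lam_dvd:
  assumes \<omega>: "\<omega> \<in> filt k D'" and U0: "U \<omega> = 0"
    and top: "\<And>J u. D < lev J u \<Longrightarrow> \<omega> J u = 0"
    and dvd: "\<And>J u. D \<le> lev J u \<Longrightarrow> lam_dvd r (\<omega> J u)"
    and Iv: "D \<le> lev I v"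
  shows "lam_dvd (Suc r) (\<omega> I v)"
proof (cases "\<omega> I v = 0")
  case False
  note f = filtD[OF \<omega> False]
  have I: "I \<subseteq> {1..m}" and vM: "v \<in> M" and vV: "v \<in> V" using f by blast+
  have finI: "finite I" using I finite_subset by blast
  \<comment> \<open>The coefficients entering here lie one level above (I, v), because an e_j has
    been removed and \<open>hop\<close> keeps the level; the cochain vanishes there.\<close>
  have E1: "gradE (hop \<omega>) I v = 0"
  proof -
    have "hop \<omega> (I - {j}) v = 0" if "j \<in> I" for j
    proof (rule hop_eq_0)
      assume "active (I - {j}) v"
      from lev_active[OF this] have "D < lev (insert (mex (I - {j})) (I - {j})) (v + a (mex (I - {j})))"
        using lev_remove[OF finI that, of v] Iv by simp
      then show "\<omega> (insert (mex (I - {j})) (I - {j})) (v + a (mex (I - {j}))) = 0" by (rule top)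
    qed
    then show ?thesis by (simp add: gradE_def)
  qed
  have E2: "hop (gradE \<omega>) I v = 0"
  proof (rule hop_eq_0)
    assume act: "active I v"
    have "\<omega> (insert (mex I) I - {j}) (v + a (mex I)) = 0" if "j \<in> insert (mex I) I" for j
      by (rule top) (use lev_active[OF act] lev_remove[of "insert (mex I) I" j "v + a (mex I)"] that finI Iv in simp)
    then show "gradE \<omega> (insert (mex I) I) (v + a (mex I)) = 0" by (simp add: gradE_def)
  qed
  \<comment> \<open>\<open>gradN\<close> and \<open>hop\<close> keep the level, so all coefficients
    involved are covered by the assumed divisibility.\<close>
  have N1: "lam_dvd r (gradN (hop \<omega>) I v)"
    unfolding gradN_def sg_def if_P[OF I]
  proof (intro lam_dvd_sum lam_dvd_sign_mult lam_dvd_of_nat_mult lam_dvd_hop)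
    fix j assume j: "j \<in> I" and act: "active (I - {j}) (v - a 0)"
    show "lam_dvd r (\<omega> (insert (mex (I - {j})) (I - {j})) (v - a 0 + a (mex (I - {j}))))"
      by (rule dvd) (use lev_active[OF act] lev_remove_a0[OF finI j vV] Iv in simp)
  qed
  have N2: "lam_dvd r (hop (gradN \<omega>) I v)"
  proof (rule lam_dvd_hop)
    assume act: "active I v"
    then have fm: "mex I \<in> {1..m}" using mex_le_m by (simp add: active_def)
    then have sub: "insert (mex I) I \<subseteq> {1..m}" using I by blast
    have wV: "v + a (mex I) \<in> V" using V_add[OF vV a_V] fm by simp
    show "lam_dvd r (gradN \<omega> (insert (mex I) I) (v + a (mex I)))"
      unfolding gradN_def sg_def if_P[OF sub]
    proof (intro lam_dvd_sum lam_dvd_sign_mult lam_dvd_of_nat_mult dvd)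
      fix j assume j: "j \<in> insert (mex I) I"
      have "finite (insert (mex I) I)" using finI by simp
      from lev_remove_a0[OF this j wV] lev_active[OF act] Iv
      show "D \<le> lev (insert (mex I) I - {j}) (v + a (mex I) - a 0)" by simp
    qed
  qed
  have "\<omega> I v + (0 + 0) - lam * (gradN (hop \<omega>) I v + hop (gradN \<omega>) I v) = 0"
    using U_eq[OF \<omega>, of I v] U0 unfolding E1 E2 by (simp only: zero_fun_apply)
  then have "\<omega> I v = lam * (gradN (hop \<omega>) I v + hop (gradN \<omega>) I v)"
    by simp
  moreover have "lam_dvd (Suc r) (lam * (gradN (hop \<omega>) I v + hop (gradN \<omega>) I v))"
    by (intro lam_dvd_lam_mult lam_dvd_add N1 N2)
  ultimately show ?thesis by simp
qed simp

text \<open>Only the highest level L of the cochain is examined, since below it the terms of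
  \<open>gradE\<close> need not vanish. After clearing denominators, \<open>U_kernel_lam_dvd\<close>
  raises the power of lambda dividing the coefficients of level L without end, so these polynomials
  vanish, contrary to the choice of L.\<close>

lemma U_kernel:
  assumes \<omega>: "\<omega> \<in> filt k D" and U0: "U \<omega> = 0"
  shows "\<omega> = 0"
proof (rule ccontr)
  assume "\<omega> \<noteq> 0"
  then obtain J0 u0 where nz0: "\<omega> J0 u0 \<noteq> 0" unfolding fun_eq_iff zero_fun_apply by blast
  define S where "S = {p \<in> cells k D. \<omega> (fst p) (snd p) \<noteq> 0}"
  have S: "(J, u) \<in> S" if "\<omega> J u \<noteq> 0" for J u
    using that \<omega> unfolding S_def filt_def by auto
  have "finite S" unfolding S_def using finite_cells by simp
  then have fin: "finite ((\<lambda>p. lev (fst p) (snd p)) ` S)" by (rule finite_imageI)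
  have ne: "(\<lambda>p. lev (fst p) (snd p)) ` S \<noteq> {}" using S[OF nz0] by blast
  define L where "L = Max ((\<lambda>p. lev (fst p) (snd p)) ` S)"
  have "L \<in> (\<lambda>p. lev (fst p) (snd p)) ` S" unfolding L_def by (rule Max_in[OF fin ne])
  then obtain J1 u1 where top1: "\<omega> J1 u1 \<noteq> 0" "lev J1 u1 = L" by (auto simp: S_def)
  have le: "lev J u \<le> L" if "\<omega> J u \<noteq> 0" for J u
    unfolding L_def by (rule Max_ge[OF fin]) (use S[OF that] in force)
  obtain q where q: "q \<noteq> 0" "\<forall>x\<in>(\<lambda>p. \<omega> (fst p) (snd p)) ` S. lam_dvd 0 (to_fract q * x)"
    using common_denominator[OF finite_imageI[OF \<open>finite S\<close>]] by blast
  define \<eta> where "\<eta> = (\<lambda>J u. to_fract q * \<omega> J u)"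
  have \<eta>: "\<eta> \<in> filt k D" unfolding \<eta>_def by (rule filt_scale[OF \<omega>])
  have U\<eta>: "U \<eta> = 0" unfolding \<eta>_def U_scale U0 by (simp add: zero_fun_def)
  have top\<eta>: "\<eta> J u = 0" if "L < lev J u" for J u
  proof -
    have "\<omega> J u = 0" using le[of J u] that by force
    then show ?thesis by (simp add: \<eta>_def)
  qed
  have base: "lam_dvd 0 (\<eta> J u)" for J u
  proof (cases "\<omega> J u = 0")
    case True
    then show ?thesis by (simp add: \<eta>_def)
  next
    case False
    from imageI[OF S[OF this], of "\<lambda>p. \<omega> (fst p) (snd p)"] show ?thesis
      unfolding \<eta>_def fst_conv snd_conv by (rule q(2)[rule_format])
  qed
  have "lam_dvd r (\<eta> J u)" if "L \<le> lev J u" for r J u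
    using that
  proof (induction r arbitrary: J u)
    case 0
    show ?case by (rule base)
  next
    case (Suc r)
    show ?case by (rule U_kernel_lam_dvd[OF \<eta> U\<eta> top\<eta> Suc.IH Suc.prems])
  qed
  then have "\<eta> J1 u1 = 0" using top1(2) lam_dvd_all_imp_0 by simp
  then show False using top1(1) q(1) by (simp add: \<eta>_def)
qed

lemma U_linear:
  "Vector_Spaces.linear (\<lambda>(c::ratfun) (\<omega> :: nat set \<Rightarrow> ('n \<Rightarrow> int) \<Rightarrow> ratfun) J u. c * \<omega> J u)
    (\<lambda>c \<omega> J u. c * \<omega> J u) U"
  by unfold_locales (auto simp: U_add U_scale)

text \<open>Stated for any U-stable subspace Z, so that a preimage of a cocycle can be found among
  the cocycles.\<close>

lemma U_surj:
  assumes Z: "cochain_space.subspace Z" "Z \<subseteq> filt k D" "U ` Z \<subseteq> Z" and z: "z \<in> Z"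
  obtains y where "y \<in> Z" "z = U y"
proof -
  obtain X where X: "finite X" "filt k D \<subseteq> cochain_space.span X" using filt_spanned by blast
  have "inj_on U Z"
  proof (rule inj_onI)
    fix x y assume xy: "x \<in> Z" "y \<in> Z" "U x = U y"
    have d: "x - y \<in> filt k D" using cochain_space.subspace_diff[OF Z(1) xy(1,2)] Z(2) by blast
    have "U y + U (x - y) = U y + 0" using xy(3) U_add[of y "x - y"] by simp
    then have "U (x - y) = 0" by (simp only: add_left_cancel)
    from U_kernel[OF d this] show "x = y" by simp
  qed
  then have "Z \<subseteq> U ` Z"
    using cochain_space.inj_on_endo_surj[OF U_linear Z(1) _ X(1) Z(3)] Z(2) X(2) by blast
  then show ?thesis using z that by blast
qed

section \<open>Cohomology\<close>

lemma grad_0: "grad 0 = 0"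
  using grad_scale[of 0 0] by (simp add: zero_fun_def)

lemma hop_0: "hop 0 = 0"
  by (simp add: fun_eq_iff hop_def)

lemma grad_grad_0: "\<omega> \<in> filt k D \<Longrightarrow> grad (grad \<omega>) = 0"
  by (intro ext) (simp only: grad_grad zero_fun_apply)

lemma grad_hop_in_coboundaries:
  assumes "\<omega> \<in> filt k D" shows "grad (hop \<omega>) \<in> coboundaries m a l k"
proof (cases k)
  case 0
  then have "hop \<omega> = 0" using hop_filt_0 assms by blast
  then have "grad (hop \<omega>) = (\<lambda>I v. 0)" by (simp only: grad_0) (simp add: zero_fun_def)
  then show ?thesis using 0 by (simp add: coboundaries_def)
next
  case (Suc k')
  then have "hop \<omega> \<in> cochains m a k'" using hop_filt filt_imp_cochains assms by blast
  then show ?thesis using Suc by (simp add: coboundaries_def)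
qed

lemma grad_grad_hop:
  assumes "\<omega> \<in> filt k D" shows "grad (grad (hop \<omega>)) = 0"
proof (cases k)
  case 0
  then have "hop \<omega> = 0" using hop_filt_0 assms by blast
  then show ?thesis by (simp only: grad_0)
next
  case (Suc k')
  then show ?thesis using grad_grad_0[OF hop_filt] assms by blast
qed

lemma cocyclesD:
  assumes "\<omega> \<in> cocycles m a l k"
  obtains D where "\<omega> \<in> filt k D" "grad \<omega> = 0"
  using assms cochains_imp_filt unfolding cocycles_def zero_fun_def by blast

lemma cocycles_subset_coboundaries:
  assumes "k < m" shows "cocycles m a l k \<subseteq> coboundaries m a l k"
proof
  fix z assume "z \<in> cocycles m a l k"
  then obtain D where z: "z \<in> filt k D" "grad z = 0" by (rule cocyclesD)
  \<comment> \<open>The preimage under U has to be a cocycle too: otherwise U would contribute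
    \<open>hop (grad y)\<close> besides the coboundary \<open>grad (hop y)\<close>.\<close>
  define Z where "Z = {\<omega> \<in> filt k D. grad \<omega> = 0}"
  have sub: "cochain_space.subspace Z"
    unfolding cochain_space.subspace_def Z_def
    using filt_0 filt_add filt_scale grad_0
    by (auto simp: grad_add grad_scale) (simp add: zero_fun_def)
  have U_Z: "U \<omega> = grad (hop \<omega>)" if "\<omega> \<in> Z" for \<omega>
  proof -
    have "\<omega> \<in> filt k D" "grad \<omega> = 0" using that by (simp_all add: Z_def)
    then show ?thesis unfolding U_def using hop_0 proj_filt_less assms by simp
  qed
  have "U ` Z \<subseteq> Z"
  proof
    fix x assume "x \<in> U ` Z"
    then obtain \<omega> where \<omega>: "\<omega> \<in> Z" "x = U \<omega>" by blast
    then have f: "\<omega> \<in> filt k D" by (simp add: Z_def)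
    have "grad x = 0" unfolding \<omega>(2) U_Z[OF \<omega>(1)] by (rule grad_grad_hop[OF f])
    then show "x \<in> Z" using U_filt[OF f] \<omega>(2) by (simp add: Z_def)
  qed
  moreover have "Z \<subseteq> filt k D" "z \<in> Z" using z by (auto simp: Z_def)
  ultimately obtain y where y: "y \<in> Z" "z = U y"
    using U_surj[OF sub] by blast
  then have "y \<in> filt k D" by (simp add: Z_def)
  from grad_hop_in_coboundaries[OF this] show "z \<in> coboundaries m a l k"
    using y U_Z by simp
qed

section \<open>A basis of the cohomology in the top degree\<close>

definition Bint :: "('n \<Rightarrow> int) set" where
  "Bint = {b \<in> calB m a. \<forall>j\<in>{1..m}. 0 < cs b j}"

text \<open>The cochain x^b e_1...e_m.\<close>

definition chi :: "('n \<Rightarrow> int) \<Rightarrow> nat set \<Rightarrow> ('n \<Rightarrow> int) \<Rightarrow> ratfun" where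
  "chi b J u = (if J = {1..m} \<and> u = b then 1 else 0)"

text \<open>The image of the projection on cochains of degree m. As with harmonic forms, each top
  cohomology class has one representative here; the homotopy kills these cochains and U fixes
  them.\<close>

definition harmonic :: "(nat set \<Rightarrow> ('n \<Rightarrow> int) \<Rightarrow> ratfun) set" where
  "harmonic = {\<omega>. \<forall>J u. \<omega> J u \<noteq> 0 \<longrightarrow> J = {1..m} \<and> u \<in> Bint}"

lemma finite_Bint: "finite Bint"
  unfolding Bint_def using finite_calB by simp

lemma Bint_iff: "u \<in> Bint \<longleftrightarrow> u \<in> V \<and> (\<forall>j\<in>{1..m}. 0 < cs u j \<and> cs u j < 1)"
  unfolding Bint_def calB_iff mem_Collect_eq using less_imp_le by blast

lemma Bint_M: "u \<in> Bint \<Longrightarrow> u \<in> M"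
  unfolding Bint_iff M_iff using coords_outside less_imp_le by (metis order_refl)

lemma inj_chi: "inj chi"
proof (rule injI)
  fix b c assume "chi b = chi c"
  then have "chi b {1..m} b = chi c {1..m} b" by simp
  then show "b = c" unfolding chi_def by (metis zero_neq_one)
qed

lemma lincomb_chi:
  "lincomb c (chi ` Bint) id J u = (if J = {1..m} \<and> u \<in> Bint then c (chi u) else 0)"
proof -
  have "lincomb c (chi ` Bint) id J u = (\<Sum>b\<in>Bint. c (chi b) * chi b J u)"
    unfolding lincomb_def id_apply
    by (subst sum.reindex[OF inj_on_subset[OF inj_chi subset_UNIV]]) (simp only: comp_def)
  also have "\<dots> = (\<Sum>b\<in>Bint. if u = b then (if J = {1..m} then c (chi u) else 0) else 0)"
    by (intro sum.cong refl) (simp add: chi_def)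
  also have "\<dots> = (if J = {1..m} \<and> u \<in> Bint then c (chi u) else 0)"
    using finite_Bint by simp
  finally show ?thesis .
qed

lemma lincomb_harmonic: "lincomb c (chi ` Bint) id \<in> harmonic"
  unfolding harmonic_def mem_Collect_eq lincomb_chi by metis

text \<open>\<open>lincomb\<close> indexes coefficients by the vectors themselves, so
  \<open>inv chi\<close> is used to recover the exponent from the basis cochain.\<close>

lemma harmonic_eq_lincomb:
  assumes "\<omega> \<in> harmonic"
  shows "\<omega> = lincomb (\<lambda>w. \<omega> {1..m} (inv chi w)) (chi ` Bint) id"
proof (intro ext)
  fix J u
  show "\<omega> J u = lincomb (\<lambda>w. \<omega> {1..m} (inv chi w)) (chi ` Bint) id J u"
    unfolding lincomb_chi inv_f_f[OF inj_chi] using assms unfolding harmonic_def by auto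
qed

lemma harmonic_add: "\<omega> \<in> harmonic \<Longrightarrow> \<eta> \<in> harmonic \<Longrightarrow> \<omega> + \<eta> \<in> harmonic"
  unfolding harmonic_def mem_Collect_eq plus_fun_apply by (metis add.right_neutral)

lemma harmonic_filt:
  assumes "\<omega> \<in> harmonic" shows "\<omega> \<in> filt m 0"
proof (rule filtI)
  fix J u assume "\<omega> J u \<noteq> 0"
  then have J: "J = {1..m}" and u: "u \<in> Bint" using assms unfolding harmonic_def by blast+
  have "deg u \<le> (\<Sum>j\<in>{1..m}. 1)"
    unfolding deg_def by (intro sum_mono) (use u in \<open>simp add: Bint_iff less_imp_le\<close>)
  then have "lev J u \<le> 0" by (simp add: lev_def J)
  then show "J \<subseteq> {1..m} \<and> card J = m \<and> u \<in> M \<and> (\<forall>j\<in>J. 0 < cs u j) \<and> lev J u \<le> 0"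
    using J u Bint_M[OF u] by (simp add: Bint_iff)
qed

lemma proj_harmonic:
  assumes \<omega>: "\<omega> \<in> filt m D" shows "proj \<omega> \<in> harmonic"
  unfolding harmonic_def mem_Collect_eq
proof (intro allI impI)
  fix J u assume "proj \<omega> J u \<noteq> 0"
  then have J: "J = {1..m}" and lt: "\<forall>i\<in>{1..m}. cs u i < 1" and nz: "\<omega> J u \<noteq> 0"
    unfolding proj_def by metis+
  then show "J = {1..m} \<and> u \<in> Bint"
    using filtD(4,5)[OF \<omega> nz] by (simp add: Bint_iff)
qed

lemma grad_top:
  assumes \<omega>: "\<omega> \<in> filt m D" shows "grad \<omega> = 0"
proof (intro ext)
  fix I v
  show "grad \<omega> I v = 0 I v"
  proof (rule ccontr)
    assume "grad \<omega> I v \<noteq> 0 I v"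
    then have "grad \<omega> I v \<noteq> 0" by simp
    from filtD(1,2)[OF grad_filt[OF \<omega>] this] show False
      using card_mono[of "{1..m}" I] by simp
  qed
qed

text \<open>A source of the homotopy has coordinate at least 1 at the index acted on, while points
  of \<open>Bint\<close> have all coordinates below 1.\<close>

lemma hop_of_harmonic:
  assumes "\<omega> \<in> harmonic" shows "hop \<omega> = 0"
proof (intro ext)
  fix I v
  have "hop \<omega> I v = 0"
  proof (rule hop_eq_0)
    assume act: "active I v"
    then have f: "mex I \<in> {1..m}" using mex_le_m by (simp add: active_def)
    have v: "v \<in> M" using act by (simp add: active_def)
    show "\<omega> (insert (mex I) I) (v + a (mex I)) = 0"
    proof (rule ccontr)
      assume "\<omega> (insert (mex I) I) (v + a (mex I)) \<noteq> 0"
      then have "v + a (mex I) \<in> Bint" using assms unfolding harmonic_def by blast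
      then have "cs (v + a (mex I)) (mex I) < 1" using f unfolding Bint_iff by blast
      then show False
        using coords_add_a[OF M_V[OF v] f, of "mex I"] M_nonneg[OF v, of "mex I"] by simp
    qed
  qed
  then show "hop \<omega> I v = 0 I v" by simp
qed

lemma U_harmonic:
  assumes "\<omega> \<in> harmonic" shows "U \<omega> = \<omega>"
proof -
  have "proj \<omega> J u = \<omega> J u" for J u
    using assms unfolding harmonic_def proj_def mem_Collect_eq Bint_iff by metis
  then have "proj \<omega> = \<omega>" by (intro ext)
  then show ?thesis
    using hop_of_harmonic[OF assms] grad_top[OF harmonic_filt[OF assms]]
    by (simp add: U_def grad_0 hop_0)
qed

lemma filt_mono: "D \<le> D' \<Longrightarrow> filt k D \<subseteq> filt k D'"
  unfolding filt_def cells_def by fastforce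

text \<open>Write w as the differential of U eta' and let y be the differential of eta'. Applying
  the differential to U eta' leaves w = \<open>grad (hop y)\<close>, so U y = w +
  \<open>proj y\<close> is harmonic and hence fixed by U. By injectivity y itself equals this
  harmonic cochain. The homotopy kills it, and w = 0.\<close>

lemma harmonic_coboundary_eq_0:
  assumes w: "w \<in> harmonic" and bd: "w \<in> coboundaries m a l m"
  shows "w = 0"
proof (cases m)
  case 0
  then show ?thesis using bd by (simp add: coboundaries_def zero_fun_def)
next
  case (Suc k)
  then obtain \<eta> where \<eta>: "\<eta> \<in> cochains m a k" "w = grad \<eta>"
    using bd by (auto simp: coboundaries_def)
  obtain D where D: "\<eta> \<in> filt k D" using cochains_imp_filt[OF \<eta>(1)] by blast
  obtain \<eta>' where \<eta>': "\<eta>' \<in> filt k D" "\<eta> = U \<eta>'"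
    using U_surj[OF subspace_filt subset_refl _ D] U_filt by blast
  define y where "y = grad \<eta>'"
  have y: "y \<in> filt m D" unfolding y_def using grad_filt[OF \<eta>'(1)] unfolding Suc[symmetric] .
  have "k < m" using Suc by simp
  have "U \<eta>' = grad (hop \<eta>') + hop y"
    unfolding U_def y_def proj_filt_less[OF \<eta>'(1) \<open>k < m\<close>] by simp
  then have wy: "w = grad (hop y)"
    unfolding \<eta>(2) \<eta>'(2) by (simp add: grad_add grad_grad_hop[OF \<eta>'(1)])
  have h: "w + proj y \<in> harmonic" by (rule harmonic_add[OF w proj_harmonic[OF y]])
  have "U y = w + proj y"
    unfolding U_def grad_top[OF y] hop_0 wy by simp
  then have "U y = U (w + proj y)" using U_harmonic[OF h] by simp
  moreover have "U (w + proj y) + U (y - (w + proj y)) = U y"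
    by (simp flip: U_add)
  ultimately have "U (y - (w + proj y)) = 0" by simp
  \<comment> \<open>Harmonic cochains have level at most 0 and y has level at most D, so
    \<open>max D 0\<close> bounds both.\<close>
  moreover have "y - (w + proj y) \<in> filt m (max D 0)"
    using y harmonic_filt[OF h] filt_mono[of D "max D 0"] filt_mono[of 0 "max D 0"]
    by (intro cochain_space.subspace_diff[OF subspace_filt]) auto
  ultimately have "y - (w + proj y) = 0" using U_kernel by blast
  then have "y = w + proj y" by simp
  then have "hop y = 0" using hop_of_harmonic[OF h] by simp
  then show "w = 0" using wy by (simp add: grad_0)
qed

lemma quotient_dim_top:
  "quotient_dim_is (cocycles m a l m) (coboundaries m a l m) (card Bint)"
  unfolding quotient_dim_is_def
proof (intro exI[of _ "chi ` Bint"] conjI allI impI ballI)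
  show "finite (chi ` Bint)" using finite_Bint by simp
  show "card (chi ` Bint) = card Bint" by (rule card_image[OF inj_on_subset[OF inj_chi subset_UNIV]])
  show "chi ` Bint \<subseteq> cocycles m a l m"
  proof
    fix w assume "w \<in> chi ` Bint"
    then obtain b where "b \<in> Bint" "w = chi b" by blast
    then have "w \<in> harmonic" unfolding harmonic_def mem_Collect_eq chi_def by metis
    then have f: "w \<in> filt m 0" by (rule harmonic_filt)
    show "w \<in> cocycles m a l m"
      using filt_imp_cochains[OF f] grad_top[OF f] by (simp add: cocycles_def zero_fun_def)
  qed
next
  fix c w assume bd: "lincomb c (chi ` Bint) id \<in> coboundaries m a l m" and "w \<in> chi ` Bint"
  then obtain b where b: "b \<in> Bint" "w = chi b" by blast
  have "lincomb c (chi ` Bint) id {1..m} b = 0"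
    unfolding harmonic_coboundary_eq_0[OF lincomb_harmonic bd] by simp
  then show "c w = 0" unfolding lincomb_chi using b by simp
next
  fix z assume "z \<in> cocycles m a l m"
  then obtain D where z: "z \<in> filt m D" by (rule cocyclesD)
  obtain y where y: "y \<in> filt m D" "z = U y"
    using U_surj[OF subspace_filt subset_refl _ z] U_filt by blast
  \<comment> \<open>In degree m every cochain is a cocycle, so \<open>hop (grad y)\<close> vanishes
    and U y is visibly a harmonic cochain plus a coboundary.\<close>
  have "z = proj y + grad (hop y)"
    unfolding y(2) U_def grad_top[OF y(1)] hop_0 by simp
  then have "z = (\<lambda>J u. lincomb (\<lambda>w. proj y {1..m} (inv chi w)) (chi ` Bint) id J u + grad (hop y) J u)"
    unfolding harmonic_eq_lincomb[OF proj_harmonic[OF y(1)], symmetric] plus_fun_def .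
  then show "\<exists>c b. b \<in> coboundaries m a l m \<and> z = (\<lambda>J u. lincomb c (chi ` Bint) id J u + b J u)"
    using grad_hop_in_coboundaries[OF y(1)] by blast
qed

section \<open>Counting the interior points\<close>

text \<open>Both sides are the product over i of 1 - [i not in S]. Expanding it by the set T of
  indices at which the 1 is chosen, the complement of T contributes its sign and the condition that
  it avoids S.\<close>

lemma alternating_superset_sum:
  assumes "S \<subseteq> {1..m}"
  shows "(\<Sum>T\<in>Pow {1..m}. (- 1) ^ (m - card T) * (if S \<subseteq> T then 1 else 0))
    = (if S = {1..m} then 1 else (0::int))"
proof -
  have "(\<Prod>i\<in>{1..m}. 1 - (if i \<in> S then 0 else 1))
      = (\<Sum>T\<in>Pow {1..m}. (- 1) ^ (card {1..m} - card T) * (\<Prod>i\<in>T. 1)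
          * (\<Prod>i\<in>{1..m} - T. if i \<in> S then 0 else (1::int)))"
    by (rule prod_diff_conv_sum') simp
  also have "\<dots> = (\<Sum>T\<in>Pow {1..m}. (- 1) ^ (m - card T) * (if S \<subseteq> T then 1 else 0))"
  proof (intro sum.cong refl)
    fix T
    have "(\<Prod>i\<in>{1..m} - T. if i \<in> S then 0 else (1::int)) = (if S \<subseteq> T then 1 else 0)"
    proof (cases "S \<subseteq> T")
      case True
      then show ?thesis by (auto intro!: prod.neutral)
    next
      case False
      then have "\<exists>i\<in>{1..m} - T. (if i \<in> S then 0 else (1::int)) = 0" using assms by auto
      then show ?thesis using False by (simp add: prod_zero)
    qed
    then show "(- 1) ^ (card {1..m} - card T) * (\<Prod>i\<in>T. 1)
          * (\<Prod>i\<in>{1..m} - T. if i \<in> S then 0 else (1::int))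
        = (- 1) ^ (m - card T) * (if S \<subseteq> T then 1 else 0)" by simp
  qed
  also have "(\<Prod>i\<in>{1..m}. 1 - (if i \<in> S then 0 else (1::int))) = (if S = {1..m} then 1 else 0)"
  proof (cases "S = {1..m}")
    case False
    then have "\<exists>i\<in>{1..m}. 1 - (if i \<in> S then 0 else (1::int)) = 0" using assms by auto
    then show ?thesis using False by (simp add: prod_zero)
  qed simp
  finally show ?thesis by simp
qed

lemma card_Bint:
  "int (card Bint) = (\<Sum>T\<in>Pow {1..m}. (- 1) ^ (m - card T) * int (card {u \<in> calB m a. in_cone m a T u}))"
proof -
  define supp where "supp u = {j \<in> {1..m}. cs u j \<noteq> 0}" for u
  have nn: "0 \<le> cs u j" if "u \<in> calB m a" for u j
    using that coords_outside[of u j] by (cases "j \<in> {1..m}") (simp_all add: calB_iff)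
  \<comment> \<open>Coordinates are unique, so for points of \<open>calB\<close> membership in a
    cone is a condition on the support alone. This turns the count for each T into a superset
    sum.\<close>
  have cone: "in_cone m a T u \<longleftrightarrow> supp u \<subseteq> T" if u: "u \<in> calB m a" for u T
  proof -
    have V: "u \<in> V" using u by (simp add: calB_iff)
    have "in_cone m a T u \<longleftrightarrow> (\<forall>j. j \<notin> T \<longrightarrow> cs u j = 0)"
      using V nn[OF u] by (simp add: in_cone_iff)
    also have "\<dots> \<longleftrightarrow> supp u \<subseteq> T"
      unfolding supp_def using coords_outside[OF V] by blast
    finally show ?thesis .
  qed
  have Bint: "u \<in> Bint \<longleftrightarrow> supp u = {1..m}" if u: "u \<in> calB m a" for u
  proof -
    have "u \<in> Bint \<longleftrightarrow> (\<forall>j\<in>{1..m}. cs u j \<noteq> 0)"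
      using u nn[OF u] unfolding Bint_def less_le by auto
    also have "\<dots> \<longleftrightarrow> supp u = {1..m}" unfolding supp_def by blast
    finally show ?thesis .
  qed
  have card_eq: "int (card {u \<in> calB m a. P u}) = (\<Sum>u\<in>calB m a. if P u then 1 else 0)" for P
    using finite_calB by (simp add: sum.If_cases Int_def)
  have "(\<Sum>T\<in>Pow {1..m}. (- 1) ^ (m - card T) * int (card {u \<in> calB m a. in_cone m a T u}))
      = (\<Sum>T\<in>Pow {1..m}. \<Sum>u\<in>calB m a. (- 1) ^ (m - card T) * (if supp u \<subseteq> T then 1 else 0))"
    unfolding card_eq sum_distrib_left by (intro sum.cong refl) (simp only: cone)
  also have "\<dots> = (\<Sum>u\<in>calB m a. \<Sum>T\<in>Pow {1..m}. (- 1) ^ (m - card T) * (if supp u \<subseteq> T then 1 else 0))"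
    by (rule sum.swap)
  also have "\<dots> = (\<Sum>u\<in>calB m a. if supp u = {1..m} then 1 else 0)"
    by (intro sum.cong refl alternating_superset_sum) (auto simp: supp_def)
  also have "\<dots> = (\<Sum>u\<in>calB m a. if u \<in> Bint then 1 else 0)"
    by (intro sum.cong refl) (simp only: Bint)
  also have "\<dots> = int (card {u \<in> calB m a. u \<in> Bint})" by (rule card_eq[symmetric])
  also have "{u \<in> calB m a. u \<in> Bint} = Bint" by (auto simp: Bint_def)
  finally show ?thesis by simp
qed

end

theorem theorem9p8:
  fixes m :: nat and a :: "nat \<Rightarrow> 'n::finite \<Rightarrow> int" and l :: "nat \<Rightarrow> nat"
  assumes lin_indep: "\<And>c :: nat \<Rightarrow> real.
      (\<forall>i. (\<Sum>j\<in>{1..m}. c j * real_of_int (a j i)) = 0) \<Longrightarrow> \<forall>j\<in>{1..m}. c j = 0"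
    and l_pos: "\<forall>j\<in>{0..m}. l j > 0"
    and l_gcd: "Gcd (l ` {0..m}) = 1"
    and rel: "\<forall>i. int (l 0) * a 0 i = (\<Sum>j\<in>{1..m}. int (l j) * a j i)"
    and l0: "l 0 = (\<Sum>j\<in>{1..m}. l j)"
  shows "(\<forall>i<m. cocycles m a l i \<subseteq> coboundaries m a l i) \<and>
    (\<exists>d. quotient_dim_is (cocycles m a l m) (coboundaries m a l m) d \<and>
       int d = (\<Sum>T\<in>Pow {1..m}. (-1) ^ (m - card T) *
                   int (card {u \<in> calB m a. in_cone m a T u})))"
proof -
  interpret dwork_data m a l
    using lin_indep l_pos rel l0 by unfold_locales
  show ?thesis
    using cocycles_subset_coboundaries quotient_dim_top card_Bint by blast
qed

end
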